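(* Let $M$ be a spherical strongly pseudoconvex analytic real hypersurface in $\mathbb{C}^{n+1}$, let $U$ be an open connected neighborhood of a point $p\in M$, and let $\phi$ be a biholomorphic mapping on $U$ such that $\phi(U\cap M)\subset S^{2n+1}$. Then $\phi$ is analytically continued along any path in $M$ (starting at $p$) as a local biholomorphic mapping.
   Context: Here $n\ge1$ and $S^{2n+1}\subset\mathbb{C}^{n+1}$ is the unit sphere. A biholomorphic mapping on $U$ is a holomorphic map that is biholomorphic onto an open image in $\mathbb{C}^{n+1}$. Use coordinates $(z,w)\in\mathbb{C}^n\times\mathbb{C}$, $w=u+iv$. A real hyperquadric is $\{v=\langle z,z\rangle\}$ with $\langle z,z\rangle=\sum_{\alpha\le e}|z^\alpha|^2-\sum_{\alpha>e}|z^\alpha|^2$. A nondegenerate analytic real hypersurface is spherical if at each of its points it is locally biholomorphic to a real hyperquadric. Analytic continuation of $\phi$ along a path $\gamma:[0,1]\to M$, $\gamma(0)=p$, as a local biholomorphic mapping: a family of germs $\phi_t$ at $\gamma(t)$ of locally biholomorphic maps, $\phi_0$ being the germ of $\phi$, such that for each $t$ the germs $\phi_s$ with $s$ near $t$ are all germs of one representative of $\phi_t$. *)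

theory Defs
  imports "HOL-Analysis.Analysis"
begin

text \<open>
  The ambient space of complex dimension $n + 1$ with $n \ge 1$ is \<open>complex^('n option)\<close>: the
  coordinates $(z, w)$ of a point \<open>x\<close> are $z^\alpha$ = \<open>x $ Some \<alpha>\<close> and $w$ = \<open>x $ None\<close>.
  Notions that do not refer to these coordinates are defined on \<open>complex^'m\<close>.
\<close>

section \<open>Holomorphic mappings\<close>

text \<open>Complex differentiability at every point of \<open>U\<close>; only meant for open \<open>U\<close>.\<close>

definition holomorphic_map_on ::
    "(complex^'m \<Rightarrow> complex^'k) \<Rightarrow> (complex^'m) set \<Rightarrow> bool" where
  "holomorphic_map_on f U \<longleftrightarrow>
     (\<forall>x\<in>U. \<exists>D. (f has_derivative D) (at x) \<and> (\<forall>c v. D (c *s v) = c *s D v))"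

definition biholomorphic_on ::
    "(complex^'m \<Rightarrow> complex^'m) \<Rightarrow> (complex^'m) set \<Rightarrow> bool" where
  "biholomorphic_on f U \<longleftrightarrow>
     open U \<and> holomorphic_map_on f U \<and> inj_on f U \<and> open (f ` U) \<and>
     holomorphic_map_on (inv_into U f) (f ` U)"

definition locally_biholomorphic_on ::
    "(complex^'m \<Rightarrow> complex^'m) \<Rightarrow> (complex^'m) set \<Rightarrow> bool" where
  "locally_biholomorphic_on f U \<longleftrightarrow>
     (\<forall>x\<in>U. \<exists>V. x \<in> V \<and> V \<subseteq> U \<and> biholomorphic_on f V)"

section \<open>Analytic real hypersurfaces and the Levi form\<close>

text \<open>
  Local expansion in a multivariate power series. The multi-indices are the functions
  \<open>\<alpha> \<in> Basis \<rightarrow>\<^sub>E UNIV\<close>; unconditional summation is absolute convergence.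
\<close>

definition real_analytic_on :: "('a::euclidean_space \<Rightarrow> real) \<Rightarrow> 'a set \<Rightarrow> bool" where
  "real_analytic_on f S \<longleftrightarrow>
     (\<forall>x\<in>S. \<exists>c :: ('a \<Rightarrow> nat) \<Rightarrow> real. \<forall>\<^sub>F h in nhds 0.
        ((\<lambda>\<alpha>. c \<alpha> * (\<Prod>b\<in>Basis. (h \<bullet> b) ^ \<alpha> b)) has_sum f (x + h))
          (Basis \<rightarrow>\<^sub>E UNIV))"

definition local_defining_function ::
    "(complex^'m) set \<Rightarrow> complex^'m \<Rightarrow> (complex^'m) set \<Rightarrow> (complex^'m \<Rightarrow> real) \<Rightarrow> bool" where
  "local_defining_function M p V r \<longleftrightarrow>
     open V \<and> p \<in> V \<and> real_analytic_on r V \<and>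
     (\<forall>x\<in>V. frechet_derivative r (at x) \<noteq> (\<lambda>_. 0)) \<and>
     M \<inter> V = {x\<in>V. r x = 0}"

definition analytic_real_hypersurface :: "(complex^'m) set \<Rightarrow> bool" where
  "analytic_real_hypersurface M \<longleftrightarrow> (\<forall>p\<in>M. \<exists>V r. local_defining_function M p V r)"

text \<open>The operators $\partial/\partial z_j$ and $\partial/\partial \bar z_j$.\<close>

definition d_z :: "'m \<Rightarrow> (complex^'m \<Rightarrow> complex) \<Rightarrow> complex^'m \<Rightarrow> complex" where
  "d_z j g x =
     (frechet_derivative g (at x) (axis j 1) - \<i> * frechet_derivative g (at x) (axis j \<i>)) / 2"

definition d_zbar :: "'m \<Rightarrow> (complex^'m \<Rightarrow> complex) \<Rightarrow> complex^'m \<Rightarrow> complex" where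
  "d_zbar j g x =
     (frechet_derivative g (at x) (axis j 1) + \<i> * frechet_derivative g (at x) (axis j \<i>)) / 2"

definition complex_tangent_space ::
    "(complex^'m \<Rightarrow> real) \<Rightarrow> complex^'m \<Rightarrow> (complex^'m) set" where
  "complex_tangent_space r x = {v. (\<Sum>j\<in>UNIV. d_z j (\<lambda>y. of_real (r y)) x * v $ j) = 0}"

definition levi_form ::
    "(complex^'m \<Rightarrow> real) \<Rightarrow> complex^'m \<Rightarrow> complex^'m \<Rightarrow> complex^'m \<Rightarrow> complex" where
  "levi_form r x v u =
     (\<Sum>j\<in>UNIV. \<Sum>k\<in>UNIV.
        d_z j (d_zbar k (\<lambda>y. of_real (r y))) x * v $ j * cnj (u $ k))"

text \<open>
  Two local defining functions at a point differ by a nonvanishing real factor, which rescales the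
  Levi form on the complex tangent space. So nondegeneracy does not depend on the choice of \<open>r\<close>,
  and definiteness depends on it only through the sign; the existential quantifier in
  \<open>strongly_pseudoconvex\<close> picks the side of \<open>M\<close> on which the form is positive.
\<close>

definition levi_nondegenerate :: "(complex^'m) set \<Rightarrow> bool" where
  "levi_nondegenerate M \<longleftrightarrow>
     (\<forall>p\<in>M. \<exists>V r. local_defining_function M p V r \<and>
        (\<forall>v\<in>complex_tangent_space r p.
           (\<forall>u\<in>complex_tangent_space r p. levi_form r p v u = 0) \<longrightarrow> v = 0))"

definition strongly_pseudoconvex :: "(complex^'m) set \<Rightarrow> bool" where
  "strongly_pseudoconvex M \<longleftrightarrow>
     (\<forall>p\<in>M. \<exists>V r. local_defining_function M p V r \<and>
        (\<forall>v\<in>complex_tangent_space r p. v \<noteq> 0 \<longrightarrow> Re (levi_form r p v v) > 0))"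

section \<open>Spherical hypersurfaces\<close>

text \<open>
  As the index type \<open>'n\<close> carries no order, \<open>P\<close> is the set of the $e$ indices whose squares enter
  $\langle z, z\rangle$ with a positive sign.
\<close>

definition real_hyperquadric :: "'n::finite set \<Rightarrow> (complex^('n option)) set" where
  "real_hyperquadric P =
     {x. Im (x $ None) =
         (\<Sum>\<alpha>\<in>P. (cmod (x $ Some \<alpha>))\<^sup>2) - (\<Sum>\<alpha>\<in>- P. (cmod (x $ Some \<alpha>))\<^sup>2)}"

definition spherical :: "(complex^('n::finite option)) set \<Rightarrow> bool" where
  "spherical M \<longleftrightarrow>
     analytic_real_hypersurface M \<and> levi_nondegenerate M \<and>
     (\<forall>p\<in>M. \<exists>V F P. p \<in> V \<and> biholomorphic_on F V \<and>
        F ` (V \<inter> M) = F ` V \<inter> real_hyperquadric P)"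

section \<open>Analytic continuation along a path\<close>

definition germ :: "('a::topological_space \<Rightarrow> 'b) \<Rightarrow> 'a \<Rightarrow> ('a \<Rightarrow> 'b) set" where
  "germ f x = {g. \<forall>\<^sub>F y in nhds x. g y = f y}"

text \<open>
  \<open>\<Phi> t\<close> is the germ at \<open>\<gamma> t\<close>, for \<open>t \<in> {0..1}\<close>. The filter \<open>at t within {0..1}\<close> leaves out
  \<open>t\<close> itself, where the germ of the representative is prescribed separately.
\<close>

definition analytic_continuation_along ::
    "(complex^'m \<Rightarrow> complex^'m) \<Rightarrow> (real \<Rightarrow> complex^'m) \<Rightarrow>
     (real \<Rightarrow> (complex^'m \<Rightarrow> complex^'m) set) \<Rightarrow> bool" where
  "analytic_continuation_along \<phi> \<gamma> \<Phi> \<longleftrightarrow>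
     \<Phi> 0 = germ \<phi> (\<gamma> 0) \<and>
     (\<forall>t\<in>{0..1}. \<exists>V f. open V \<and> \<gamma> t \<in> V \<and> locally_biholomorphic_on f V \<and>
        \<Phi> t = germ f (\<gamma> t) \<and>
        (\<forall>\<^sub>F s in at t within {0..1}. \<gamma> s \<in> V \<and> \<Phi> s = germ f (\<gamma> s)))"

end

theory Submission
  imports Defs "HOL-Complex_Analysis.Conformal_Mappings"
begin

text \<open>
  The heart of the matter is the rigidity of maps of a hyperquadric \<open>Q\<close> into the sphere, going back to
  Poincare and Tanaka: a germ of a biholomorphic map that sends \<open>Q\<close> into the sphere is the germ of
  a projective linear map, and this map is defined and biholomorphic near all of \<open>Q\<close> and sends all
  of \<open>Q\<close> into the sphere (\<open>sphere_map_extends_to_hyperquadric\<close>). In a chart \<open>F\<close> that takes \<open>M\<close> into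
  \<open>Q\<close>, a germ \<open>f\<close> of a map of \<open>M\<close> into the sphere turns into the germ $f \circ F^{-1}$ on \<open>Q\<close>, so \<open>f\<close>
  extends at one stroke over the part of \<open>M\<close> in the chart (\<open>sphere_map_extends_over_chart\<close>).
  By compactness finitely many charts lead to the end of the path.

  Rigidity is proved as follows. Translations of the Heisenberg group act transitively on \<open>Q\<close>, so let
  the germ \<open>f\<close> be at the origin. The equation \<open>cdot (f x) (f x) = 1\<close> on \<open>Q\<close> polarizes to
  \<open>cdot (f x) (f y) = 1\<close> whenever $w - \bar\omega = 2i\langle z,\zeta\rangle$, where
  $x = (z,w)$ and $y = (\zeta,\omega)$ (\<open>polarization\<close>). For fixed \<open>y\<close> this condition describes a complex
  hyperplane, the Segre variety of \<open>y\<close>. It passes through the origin when $\omega = 0$, and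
  $\psi = f'(0)^{-1}(f - f(0))$ maps such a hyperplane into itself: the polarized equation says that
  the image lies in some hyperplane, and the derivative at the origin tells which. Intersecting
  hyperplanes, $\psi$ preserves the complex lines through the origin, that is, $\psi(x) = x/m(x)$ with a
  scalar function $m$. With this the polarized equation becomes an equation that is linear in $m$,
  from which $m$ is seen to be affine, and $f = f(0) + f'(0)x/m(x)$ is projective linear
  (\<open>sphere_map_locally_projective\<close>).

  Finally write $f = N/d$ with affine \<open>N\<close> and \<open>d\<close>. The equation $|N|^2 = |d|^2$ holds on \<open>Q\<close> near
  the origin; as \<open>Q\<close> is a graph over a real vector space, it holds on all of \<open>Q\<close>. Since \<open>N\<close> and \<open>d\<close> have no
  common zero, \<open>d\<close> does not vanish on \<open>Q\<close> (\<open>sphere_map_extends_at_0\<close>).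
\<close>

section \<open>Holomorphic functions of several variables\<close>

definition holomorphic_fun_on :: "(complex^'m \<Rightarrow> complex) \<Rightarrow> (complex^'m) set \<Rightarrow> bool" where
  "holomorphic_fun_on g U \<longleftrightarrow>
     (\<forall>x\<in>U. \<exists>D. (g has_derivative D) (at x) \<and> (\<forall>c v. D (c *s v) = c * D v))"

lemma has_derivative_vec_componentwise:
  fixes f :: "'a::real_normed_vector \<Rightarrow> complex^'k"
  assumes "\<And>k. ((\<lambda>x. f x $ k) has_derivative (\<lambda>v. D v $ k)) (at x)"
  shows "(f has_derivative D) (at x)"
proof (subst has_derivative_componentwise_within, intro ballI)
  fix i :: "complex^'k"
  assume "i \<in> Basis"
  then obtain k b where "i = axis k b"
    by (auto simp: Basis_vec_def)
  then show "((\<lambda>x. f x \<bullet> i) has_derivative (\<lambda>x. D x \<bullet> i)) (at x)"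
    using has_derivative_inner_left[OF assms, of k b] by (simp add: inner_axis)
qed

lemma holomorphic_map_on_iff_components:
  "holomorphic_map_on f U \<longleftrightarrow> (\<forall>k. holomorphic_fun_on (\<lambda>x. f x $ k) U)"
proof
  assume f: "holomorphic_map_on f U"
  show "\<forall>k. holomorphic_fun_on (\<lambda>x. f x $ k) U"
    unfolding holomorphic_fun_on_def
  proof (intro allI ballI)
    fix k x assume "x \<in> U"
    then obtain D where "(f has_derivative D) (at x)" "\<And>c v. D (c *s v) = c *s D v"
      using f by (auto simp: holomorphic_map_on_def)
    then show "\<exists>D. ((\<lambda>x. f x $ k) has_derivative D) (at x) \<and> (\<forall>c v. D (c *s v) = c * D v)"
      by (intro exI[of _ "\<lambda>v. D v $ k"])
        (auto intro!: bounded_linear.has_derivative[OF bounded_linear_vec_nth])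
  qed
next
  assume f: "\<forall>k. holomorphic_fun_on (\<lambda>x. f x $ k) U"
  show "holomorphic_map_on f U"
    unfolding holomorphic_map_on_def
  proof
    fix x assume "x \<in> U"
    then have "\<forall>k. \<exists>D. ((\<lambda>x. f x $ k) has_derivative D) (at x) \<and> (\<forall>c v. D (c *s v) = c * D v)"
      using f by (auto simp: holomorphic_fun_on_def)
    then obtain D where D: "\<And>k. ((\<lambda>x. f x $ k) has_derivative D k) (at x)"
        "\<And>k c v. D k (c *s v) = c * D k v"
      by metis
    show "\<exists>D. (f has_derivative D) (at x) \<and> (\<forall>c v. D (c *s v) = c *s D v)"
      using D by (intro exI[of _ "\<lambda>v. \<chi> k. D k v"] conjI has_derivative_vec_componentwise)
        (auto simp: vec_eq_iff)
  qed
qed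

lemma holomorphic_fun_on_const [simp]: "holomorphic_fun_on (\<lambda>_. c) U"
  unfolding holomorphic_fun_on_def by (intro ballI exI[of _ "\<lambda>_. 0"]) auto

lemma holomorphic_fun_on_coord [simp]: "holomorphic_fun_on (\<lambda>x. x $ k) U"
  unfolding holomorphic_fun_on_def
  by (intro ballI exI[of _ "\<lambda>v. v $ k"]) (auto intro!: bounded_linear_imp_has_derivative)

lemma holomorphic_fun_on_add:
  assumes "holomorphic_fun_on f U" "holomorphic_fun_on g U"
  shows "holomorphic_fun_on (\<lambda>x. f x + g x) U"
  unfolding holomorphic_fun_on_def
proof
  fix x assume "x \<in> U"
  then obtain D E where "(f has_derivative D) (at x)" "\<And>c v. D (c *s v) = c * D v"
     "(g has_derivative E) (at x)" "\<And>c v. E (c *s v) = c * E v"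
    using assms unfolding holomorphic_fun_on_def by meson
  then show "\<exists>D. ((\<lambda>x. f x + g x) has_derivative D) (at x) \<and> (\<forall>c v. D (c *s v) = c * D v)"
    by (intro exI[of _ "\<lambda>v. D v + E v"]) (auto intro!: has_derivative_add simp: algebra_simps)
qed

lemma holomorphic_fun_on_mult:
  assumes "holomorphic_fun_on f U" "holomorphic_fun_on g U"
  shows "holomorphic_fun_on (\<lambda>x. f x * g x) U"
  unfolding holomorphic_fun_on_def
proof
  fix x assume "x \<in> U"
  then obtain D E where "(f has_derivative D) (at x)" "\<And>c v. D (c *s v) = c * D v"
     "(g has_derivative E) (at x)" "\<And>c v. E (c *s v) = c * E v"
    using assms unfolding holomorphic_fun_on_def by meson
  then show "\<exists>D. ((\<lambda>x. f x * g x) has_derivative D) (at x) \<and> (\<forall>c v. D (c *s v) = c * D v)"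
    by (intro exI[of _ "\<lambda>v. f x * E v + D v * g x"] conjI has_derivative_mult)
       (auto simp: algebra_simps)
qed

lemma holomorphic_fun_on_compose_outer:
  assumes "holomorphic_fun_on f U" "\<And>x. x \<in> U \<Longrightarrow> h field_differentiable at (f x)"
  shows "holomorphic_fun_on (\<lambda>x. h (f x)) U"
  unfolding holomorphic_fun_on_def
proof
  fix x assume "x \<in> U"
  then obtain D d where D: "(f has_derivative D) (at x)" "\<And>c v. D (c *s v) = c * D v"
     and d: "(h has_field_derivative d) (at (f x))"
    using assms unfolding holomorphic_fun_on_def field_differentiable_def by meson
  have "((\<lambda>x. h (f x)) has_derivative (\<lambda>v. d * D v)) (at x)"
    using has_derivative_compose[OF D(1) d[unfolded has_field_derivative_def]] .
  with D(2) show "\<exists>D. ((\<lambda>x. h (f x)) has_derivative D) (at x) \<and> (\<forall>c v. D (c *s v) = c * D v)"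
    by (intro exI[of _ "\<lambda>v. d * D v"]) auto
qed

lemma holomorphic_fun_on_divide:
  assumes "holomorphic_fun_on f U" "holomorphic_fun_on g U" "\<And>x. x \<in> U \<Longrightarrow> g x \<noteq> 0"
  shows "holomorphic_fun_on (\<lambda>x. f x / g x) U"
proof -
  have "holomorphic_fun_on (\<lambda>x. inverse (g x)) U"
    by (rule holomorphic_fun_on_compose_outer[of g U inverse])
      (use assms in \<open>auto intro: field_differentiable_inverse\<close>)
  then have "holomorphic_fun_on (\<lambda>x. f x * inverse (g x)) U"
    by (rule holomorphic_fun_on_mult[OF assms(1)])
  then show ?thesis by (simp add: divide_inverse)
qed

lemma holomorphic_fun_on_sum:
  "(\<And>i. i \<in> I \<Longrightarrow> holomorphic_fun_on (f i) U) \<Longrightarrow> holomorphic_fun_on (\<lambda>x. \<Sum>i\<in>I. f i x) U"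
  by (induction I rule: infinite_finite_induct) (auto intro!: holomorphic_fun_on_add)

lemma holomorphic_fun_on_diff:
  assumes "holomorphic_fun_on f U" "holomorphic_fun_on g U"
  shows "holomorphic_fun_on (\<lambda>x. f x - g x) U"
  using holomorphic_fun_on_add[OF assms(1) holomorphic_fun_on_mult[OF _ assms(2), of "\<lambda>_. -1"]]
  by simp

lemmas holomorphic_fun_intros = holomorphic_fun_on_const holomorphic_fun_on_coord
  holomorphic_fun_on_add holomorphic_fun_on_diff holomorphic_fun_on_mult
  holomorphic_fun_on_sum

lemma holomorphic_fun_on_compose_map:
  assumes "holomorphic_fun_on g W" "holomorphic_map_on f U" "f ` U \<subseteq> W"
  shows "holomorphic_fun_on (\<lambda>x. g (f x)) U"
  unfolding holomorphic_fun_on_def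
proof
  fix x assume "x \<in> U"
  then obtain D E where D: "(f has_derivative D) (at x)" "\<And>c v. D (c *s v) = c *s D v"
     and E: "(g has_derivative E) (at (f x))" "\<And>c v. E (c *s v) = c * E v"
    using assms unfolding holomorphic_fun_on_def holomorphic_map_on_def
    by (meson image_subset_iff)
  show "\<exists>D. ((\<lambda>x. g (f x)) has_derivative D) (at x) \<and> (\<forall>c v. D (c *s v) = c * D v)"
    using has_derivative_compose[OF D(1) E(1)] D(2) E(2) by (intro exI[of _ "\<lambda>v. E (D v)"]) auto
qed

lemma holomorphic_map_on_compose:
  assumes "holomorphic_map_on g W" "holomorphic_map_on f U" "f ` U \<subseteq> W"
  shows "holomorphic_map_on (\<lambda>x. g (f x)) U"
  using assms by (auto simp: holomorphic_map_on_iff_components[of g]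
      holomorphic_map_on_iff_components[of "\<lambda>x. g (f x)"] intro: holomorphic_fun_on_compose_map)

lemma holomorphic_map_on_subset:
  "holomorphic_map_on f U \<Longrightarrow> V \<subseteq> U \<Longrightarrow> holomorphic_map_on f V"
  by (auto simp: holomorphic_map_on_def)

lemma holomorphic_fun_on_subset:
  "holomorphic_fun_on f U \<Longrightarrow> V \<subseteq> U \<Longrightarrow> holomorphic_fun_on f V"
  by (auto simp: holomorphic_fun_on_def)

lemma holomorphic_map_on_imp_continuous_on:
  "holomorphic_map_on f U \<Longrightarrow> continuous_on U f"
  unfolding holomorphic_map_on_def
  by (meson continuous_at_imp_continuous_on has_derivative_continuous)

lemma holomorphic_fun_on_imp_continuous_on:
  "holomorphic_fun_on f U \<Longrightarrow> continuous_on U f"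
  unfolding holomorphic_fun_on_def
  by (meson continuous_at_imp_continuous_on has_derivative_continuous)

text \<open>
  Every use of one-variable theory below goes through this lemma: a statement in several variables is
  tested along a suitable holomorphic curve.
\<close>

lemma holomorphic_on_compose_curve:
  assumes g: "holomorphic_fun_on g U" and S: "open S" "c ` S \<subseteq> U"
    and c: "\<And>k. (\<lambda>\<tau>. c \<tau> $ k) holomorphic_on S"
  shows "(\<lambda>\<tau>. g (c \<tau>)) holomorphic_on S"
proof -
  have "\<exists>d. ((\<lambda>\<tau>. g (c \<tau>)) has_field_derivative d) (at \<tau>)" if \<tau>: "\<tau> \<in> S" for \<tau>
  proof -
    obtain E where E: "(g has_derivative E) (at (c \<tau>))" "\<And>c v. E (c *s v) = c * E v"
      using g S \<tau> unfolding holomorphic_fun_on_def by (meson image_subset_iff)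
    have "\<forall>k. \<exists>d. ((\<lambda>\<tau>. c \<tau> $ k) has_field_derivative d) (at \<tau>)"
      using c S \<tau> by (meson field_differentiable_def holomorphic_on_imp_differentiable_at)
    then obtain d where d: "\<And>k. ((\<lambda>\<tau>. c \<tau> $ k) has_field_derivative d k) (at \<tau>)"
      by metis
    have "(c has_derivative (\<lambda>h. h *s (\<chi> k. d k))) (at \<tau>)"
    proof (rule has_derivative_vec_componentwise)
      fix k
      have "(\<lambda>h. (h *s (\<chi> k. d k)) $ k) = (*) (d k)"
        by (simp add: fun_eq_iff mult.commute)
      then show "((\<lambda>\<tau>. c \<tau> $ k) has_derivative (\<lambda>h. (h *s (\<chi> k. d k)) $ k)) (at \<tau>)"
        using d[of k] by (simp only: has_field_derivative_def)
    qed
    from has_derivative_compose[OF this E(1)]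
    have "((\<lambda>\<tau>. g (c \<tau>)) has_derivative (\<lambda>h. E (\<chi> k. d k) * h)) (at \<tau>)"
      by (simp add: E(2) mult.commute)
    then have "((\<lambda>\<tau>. g (c \<tau>)) has_derivative (*) (E (\<chi> k. d k))) (at \<tau>)"
      .
    then show ?thesis unfolding has_field_derivative_def by blast
  qed
  then show ?thesis
    using S(1) by (simp add: holomorphic_on_open)
qed

text \<open>
  The complex line through \<open>x1\<close> and \<open>x\<close> meets a convex \<open>U\<close> in a connected set, so the identity theorem
  in one variable applies on it.
\<close>

lemma holomorphic_fun_identity:
  assumes g: "holomorphic_fun_on g U" and U: "open U" "convex U"
    and x1: "x1 \<in> U" "\<forall>\<^sub>F x in nhds x1. g x = 0" and x: "x \<in> U"
  shows "g x = 0"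
proof -
  define c where "c = (\<lambda>\<tau>::complex. x1 + \<tau> *s (x - x1))"
  define S where "S = c -` U"
  have cont: "continuous_on UNIV c"
    unfolding c_def vector_scalar_mult_def
    by (intro continuous_intros)
  have S: "open S" unfolding S_def using cont U by (simp add: open_vimage)
  have "c (u *\<^sub>R a + v *\<^sub>R b) = u *\<^sub>R c a + v *\<^sub>R c b" if "u + v = 1" for u v a b
  proof -
    have "v = 1 - u" using that by simp
    then show ?thesis
      by (simp add: c_def vec_eq_iff)
         (simp add: algebra_simps scaleR_conv_of_real)
  qed
  then have "convex S"
    using U(2) by (auto simp: S_def convex_def)
  then have conn: "connected S" by (rule convex_connected)
  have hol: "(\<lambda>\<tau>. g (c \<tau>)) holomorphic_on S"
    by (rule holomorphic_on_compose_curve[OF g S]) (auto simp: S_def c_def intro!: holomorphic_intros)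
  have "(c \<longlongrightarrow> c 0) (nhds 0)"
    using cont by (metis UNIV_I continuous_on_eq_continuous_at isCont_def open_UNIV tendsto_nhds_iff)
  then have "filterlim c (nhds x1) (nhds 0)" by (simp add: c_def)
  with x1(2) have ev: "\<forall>\<^sub>F \<tau> in nhds 0. g (c \<tau>) = 0"
    by (rule eventually_compose_filterlim)
  then obtain T where T: "open T" "0 \<in> T" "\<And>\<tau>. \<tau> \<in> T \<Longrightarrow> g (c \<tau>) = 0"
    by (auto simp: eventually_nhds)
  have 0: "0 \<in> S" and 1: "1 \<in> S" using x1 x by (auto simp: S_def c_def)
  have "g (c 1) = 0"
  proof (rule analytic_continuation[OF hol S conn, of "S \<inter> T" 0 1])
    show "0 islimpt (S \<inter> T)"
      using S T 0 by (intro interior_limit_point) (auto simp: interior_open open_Int)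
  qed (use T 0 1 in auto)
  then show ?thesis by (simp add: c_def)
qed

lemma real_axis_identity:
  assumes h: "h holomorphic_on S" and S: "open S" "connected S" "0 \<in> S" "w \<in> S"
    and e: "e > 0" "\<And>t::real. \<bar>t\<bar> < e \<Longrightarrow> h (of_real t) = 0"
  shows "h w = 0"
proof (rule analytic_continuation[OF h S(1,2), of "S \<inter> of_real ` {-e<..<e}" 0])
  show "0 islimpt (S \<inter> of_real ` {-e<..<e})"
  proof (subst islimpt_approachable, intro allI impI)
    fix d :: real assume d: "d > 0"
    obtain r where r: "r > 0" "ball 0 r \<subseteq> S" using S by (auto simp: open_contains_ball)
    define t where "t = min d (min r e) / 2"
    have t: "0 < t" "t < d" "t < r" "t < e" using d r e by (auto simp: t_def)
    have "complex_of_real t \<in> S" using r t by (auto simp: subset_iff dist_norm)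
    with t show "\<exists>x'\<in>S \<inter> of_real ` {-e<..<e}. x' \<noteq> 0 \<and> dist x' 0 < d"
      by (intro bexI[of _ "of_real t"]) auto
  qed
qed (use S e in auto)

section \<open>Biholomorphic maps\<close>

text \<open>
  A way around \<open>inv_into\<close>: any holomorphic left inverse will do.
\<close>

lemma biholomorphic_onI:
  assumes "open U" "holomorphic_map_on f U" "open (f ` U)" "holomorphic_map_on g (f ` U)"
    "\<And>x. x \<in> U \<Longrightarrow> g (f x) = x"
  shows "biholomorphic_on f U"
proof -
  have inj: "inj_on f U" using assms(5) by (metis inj_onI)
  have "holomorphic_map_on (inv_into U f) (f ` U)"
    unfolding holomorphic_map_on_def
  proof
    fix y assume y: "y \<in> f ` U"
    then obtain D where D: "(g has_derivative D) (at y)" "\<forall>c v. D (c *s v) = c *s D v"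
      using assms(4) by (auto simp: holomorphic_map_on_def)
    have "(inv_into U f has_derivative D) (at y)"
      by (rule has_derivative_transform_within_open[OF D(1) assms(3) y])
         (use assms(5) inj in auto)
    with D(2) show "\<exists>D. (inv_into U f has_derivative D) (at y) \<and> (\<forall>c v. D (c *s v) = c *s D v)"
      by blast
  qed
  with assms inj show ?thesis by (auto simp: biholomorphic_on_def)
qed

lemma biholomorphic_on_open_subset:
  assumes f: "biholomorphic_on f U" and V: "open V" "V \<subseteq> U"
  shows "biholomorphic_on f V"
proof (rule biholomorphic_onI[of _ _ "inv_into U f"])
  have "f ` V = f ` U \<inter> inv_into U f -` V"
  proof (intro equalityI subsetI)
    fix y assume "y \<in> f ` U \<inter> inv_into U f -` V"
    then show "y \<in> f ` V" by (metis IntD1 IntD2 f_inv_into_f imageI vimageD)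
  qed (use f V in \<open>auto simp: biholomorphic_on_def subset_iff\<close>)
  moreover have "open (f ` U \<inter> inv_into U f -` V)"
    using f V by (intro continuous_open_preimage holomorphic_map_on_imp_continuous_on)
      (auto simp: biholomorphic_on_def)
  ultimately show "open (f ` V)" by simp
  show "holomorphic_map_on f V" "holomorphic_map_on (inv_into U f) (f ` V)"
    using f V by (auto simp: biholomorphic_on_def
        elim!: holomorphic_map_on_subset[of f U] holomorphic_map_on_subset[of "inv_into U f" "f ` U"])
  show "inv_into U f (f x) = x" if "x \<in> V" for x
    using f V that by (simp add: biholomorphic_on_def subset_iff)
qed (fact V)

lemma biholomorphic_on_compose:
  assumes f: "biholomorphic_on f U" and g: "biholomorphic_on g W" and "f ` U \<subseteq> W"
  shows "biholomorphic_on (\<lambda>x. g (f x)) U"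
proof (rule biholomorphic_onI[of _ _ "\<lambda>y. inv_into U f (inv_into W g y)"])
  have gf: "biholomorphic_on g (f ` U)"
    using biholomorphic_on_open_subset[OF g] assms by (auto simp: biholomorphic_on_def)
  have im: "(\<lambda>x. g (f x)) ` U = g ` f ` U" by auto
  show "open U" "holomorphic_map_on (\<lambda>x. g (f x)) U"
    using assms by (auto simp: biholomorphic_on_def intro: holomorphic_map_on_compose)
  show "open ((\<lambda>x. g (f x)) ` U)" unfolding im using gf by (auto simp: biholomorphic_on_def)
  show "holomorphic_map_on (\<lambda>y. inv_into U f (inv_into W g y)) ((\<lambda>x. g (f x)) ` U)"
    using assms unfolding im
    by (intro holomorphic_map_on_compose[of "inv_into U f" "f ` U" "inv_into W g"])
       (auto simp: biholomorphic_on_def subset_iff intro: holomorphic_map_on_subset)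
  show "inv_into U f (inv_into W g (g (f x))) = x" if "x \<in> U" for x
    using that assms by (auto simp: biholomorphic_on_def subset_iff)
qed

lemma biholomorphic_on_inv_into:
  assumes "biholomorphic_on f U"
  shows "biholomorphic_on (inv_into U f) (f ` U)"
proof (rule biholomorphic_onI[of _ _ f])
  have "inv_into U f ` f ` U = U"
    using assms by (auto simp: biholomorphic_on_def)
  then show "open (inv_into U f ` f ` U)" "holomorphic_map_on f (inv_into U f ` f ` U)"
    using assms by (auto simp: biholomorphic_on_def)
  show "open (f ` U)" "holomorphic_map_on (inv_into U f) (f ` U)"
    using assms by (simp_all add: biholomorphic_on_def)
  show "f (inv_into U f y) = y" if "y \<in> f ` U" for y
    using that by (rule f_inv_into_f)
qed

lemma biholomorphic_on_imp_locally: "biholomorphic_on f U \<Longrightarrow> locally_biholomorphic_on f U"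
  by (auto simp: locally_biholomorphic_on_def)

section \<open>Hyperquadrics and their polarization\<close>

definition cdot :: "complex^'m \<Rightarrow> complex^'m \<Rightarrow> complex" where
  "cdot x y = (\<Sum>i\<in>UNIV. x $ i * cnj (y $ i))"

definition qform :: "'n::finite set \<Rightarrow> complex^('n option) \<Rightarrow> complex^('n option) \<Rightarrow> complex" where
  "qform P x y = (\<Sum>\<alpha>\<in>UNIV. (if \<alpha> \<in> P then 1 else -1) * (x $ Some \<alpha> * cnj (y $ Some \<alpha>)))"

lemma cdot_simps [simp]:
  "cdot (x + x') y = cdot x y + cdot x' y" "cdot x (y + y') = cdot x y + cdot x y'"
  "cdot (x - x') y = cdot x y - cdot x' y" "cdot x (y - y') = cdot x y - cdot x y'"
  "cdot (c *s x) y = c * cdot x y" "cdot x (c *s y) = cnj c * cdot x y"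
  "cdot 0 y = 0" "cdot x 0 = 0"
  by (simp_all add: cdot_def algebra_simps sum.distrib sum_subtractf sum_distrib_left)

lemma cnj_cdot: "cnj (cdot x y) = cdot y x"
  by (simp add: cdot_def mult.commute)

lemma cdot_self: "cdot x x = of_real ((norm x)\<^sup>2)"
proof -
  have "(norm x)\<^sup>2 = (\<Sum>i\<in>UNIV. (cmod (x $ i))\<^sup>2)"
    by (simp add: norm_vec_def L2_set_def sum_nonneg)
  then show ?thesis
    by (simp add: cdot_def flip: complex_norm_square)
qed

lemma cdot_self_eq_0_iff [simp]: "cdot x x = 0 \<longleftrightarrow> x = 0"
  by (simp add: cdot_self)

lemma in_unit_sphere_iff: "x \<in> sphere 0 1 \<longleftrightarrow> cdot x x = 1"
proof -
  have "cdot x x = 1 \<longleftrightarrow> (norm x)\<^sup>2 = 1"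
    unfolding cdot_self using of_real_eq_1_iff by blast
  also have "\<dots> \<longleftrightarrow> norm x = 1" using norm_ge_zero[of x] by (auto simp: power2_eq_1_iff simp del: norm_ge_zero)
  finally show ?thesis by simp
qed

lemma qform_simps [simp]:
  "qform P (x + x') y = qform P x y + qform P x' y" "qform P x (y + y') = qform P x y + qform P x y'"
  "qform P (x - x') y = qform P x y - qform P x' y" "qform P x (y - y') = qform P x y - qform P x y'"
  "qform P (c *s x) y = c * qform P x y" "qform P x (c *s y) = cnj c * qform P x y"
  "qform P (- x) y = - qform P x y" "qform P x (- y) = - qform P x y"
  "qform P 0 y = 0" "qform P x 0 = 0"
  "qform P (axis None c) y = 0" "qform P x (axis None c) = 0"
  "qform P (axis (Some \<alpha>) c) y = (if \<alpha> \<in> P then 1 else -1) * (c * cnj (y $ Some \<alpha>))"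
  "qform P x (axis (Some \<alpha>) c) = (if \<alpha> \<in> P then 1 else -1) * (x $ Some \<alpha> * cnj c)"
  by (simp_all add: qform_def algebra_simps sum.distrib sum_subtractf sum_distrib_left sum_negf
      axis_def if_distrib[of cnj] if_distrib[of "\<lambda>a. _ * a"] if_distrib[of "\<lambda>a. a * _"]
      cong: if_cong)

lemma cnj_qform: "cnj (qform P x y) = qform P y x"
  by (simp add: qform_def mult.commute if_distrib[of cnj] cong: if_cong)

lemma norm_qform_le:
  fixes x y :: "complex^('n::finite option)"
  shows "cmod (qform P x y) \<le> CARD('n) * (norm x * norm y)"
proof -
  have "cmod (qform P x y) \<le> (\<Sum>\<alpha>\<in>(UNIV :: 'n set). norm x * norm y)"
    unfolding qform_def
    by (intro sum_norm_le) (auto simp: norm_mult intro!: mult_mono Finite_Cartesian_Product.norm_nth_le)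
  then show ?thesis by simp
qed

text \<open>
  \<open>{x. segre P x y}\<close> is the Segre variety of \<open>y\<close>, a complex hyperplane. Its equation is the equation of
  the hyperquadric with the conjugated variables made independent of the others.
\<close>

definition segre :: "'n::finite set \<Rightarrow> complex^('n option) \<Rightarrow> complex^('n option) \<Rightarrow> bool" where
  "segre P x y \<longleftrightarrow> x $ None - cnj (y $ None) = 2 * \<i> * qform P x y"

lemma in_hyperquadric_iff: "x \<in> real_hyperquadric P \<longleftrightarrow> Im (x $ None) = Re (qform P x x)"
proof -
  have "Re (qform P x x) = (\<Sum>\<alpha>\<in>UNIV. if \<alpha> \<in> P then (cmod (x $ Some \<alpha>))\<^sup>2 else - (cmod (x $ Some \<alpha>))\<^sup>2)"
    unfolding qform_def Re_sum
    by (intro sum.cong refl) (simp add: cmod_power2, simp add: power2_eq_square)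
  also have "\<dots> = (\<Sum>\<alpha>\<in>P. (cmod (x $ Some \<alpha>))\<^sup>2) - (\<Sum>\<alpha>\<in>- P. (cmod (x $ Some \<alpha>))\<^sup>2)"
    by (subst sum.If_cases) (auto simp: sum_negf Compl_eq)
  finally show ?thesis by (simp add: real_hyperquadric_def)
qed

lemma Im_qform_self [simp]: "Im (qform P x x) = 0"
  using arg_cong[OF cnj_qform[of P x x], of Im] by simp

lemma in_hyperquadric_iff_segre: "x \<in> real_hyperquadric P \<longleftrightarrow> segre P x x"
  by (auto simp: in_hyperquadric_iff segre_def complex_eq_iff)

lemma norm_vector_smult: "norm (c *s (x :: complex^'m)) = cmod c * norm x"
  by (simp add: norm_vec_def norm_mult L2_set_right_distrib)

lemma norm_axis_eq: "norm (axis k c :: complex^'m) = cmod c"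
proof -
  have "(\<lambda>i. cmod ((axis k c :: complex^'m) $ i)) = (\<lambda>i. if i = k then cmod c else 0)"
    by (auto simp: axis_def)
  then show ?thesis
    by (simp add: norm_vec_def L2_set_def if_distrib[of "\<lambda>a. a\<^sup>2"] cong: if_cong)
qed

text \<open>
  Let the last coordinates of \<open>a\<close> and \<open>b\<close> be real. As the hyperquadric is the graph of
  $v = \langle z,z\rangle$ over the real vector space of all $(z,u)$, the line $t \mapsto a + tb$ there lifts to
  a real curve on the hyperquadric. \<open>qcurve P a b\<close> is its holomorphic extension to complex parameters:
  conjugating \<open>\<tau>\<close> in the second argument of the form makes $\langle z,z\rangle$ a polynomial in \<open>\<tau>\<close>.
\<close>

definition qcurve :: "'n::finite set \<Rightarrow> complex^('n option) \<Rightarrow> complex^('n option) \<Rightarrow>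
    complex \<Rightarrow> complex^('n option)" where
  "qcurve P a b \<tau> = a + \<tau> *s b + axis None (\<i> * qform P (a + \<tau> *s b) (a + cnj \<tau> *s b))"

lemma qcurve_holomorphic: "(\<lambda>\<tau>. qcurve P a b \<tau> $ k) holomorphic_on S"
proof -
  have "(\<lambda>\<tau>. qcurve P a b \<tau> $ k) =
     (\<lambda>\<tau>. a $ k + \<tau> * b $ k + (if k = None then \<i> else 0) *
        (qform P a a + \<tau> * qform P a b + \<tau> * qform P b a + \<tau> * \<tau> * qform P b b))"
    by (auto simp: fun_eq_iff qcurve_def axis_def algebra_simps)
  then show ?thesis by (auto intro!: holomorphic_intros)
qed

lemma segre_qcurve:
  assumes "Im (a $ None) = 0" "Im (b $ None) = 0"
  shows "segre P (qcurve P a b \<tau>) (qcurve P a b (cnj \<tau>))"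
proof -
  have [simp]: "cnj (a $ None) = a $ None" "cnj (b $ None) = b $ None"
    using assms by (auto simp: complex_eq_iff)
  show ?thesis
    by (simp add: segre_def qcurve_def cnj_qform algebra_simps)
qed

lemma qcurve_in_hyperquadric:
  assumes "Im (a $ None) = 0" "Im (b $ None) = 0"
  shows "qcurve P a b (of_real t) \<in> real_hyperquadric P"
  using segre_qcurve[OF assms, of P "of_real t"] by (simp add: in_hyperquadric_iff_segre)

lemma norm_qcurve_le:
  fixes a b :: "complex^('n::finite option)" and s :: real
  assumes "norm a \<le> s" "norm b \<le> s" "cmod \<tau> \<le> 2" "3 * s \<le> 1"
  shows "norm (qcurve P a b \<tau>) \<le> (1 + CARD('n)) * (3 * s)"
proof -
  have s: "0 \<le> s" using assms(1) norm_ge_zero order_trans by blast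
  have v: "norm (a + t *s b) \<le> 3 * s" if "cmod t \<le> 2" for t
  proof -
    have "norm (a + t *s b) \<le> norm a + cmod t * norm b"
      by (metis norm_triangle_ineq norm_vector_smult)
    also have "cmod t * norm b \<le> 2 * s" using that assms s by (intro mult_mono) auto
    finally show ?thesis using assms(1) by linarith
  qed
  let ?q = "qform P (a + \<tau> *s b) (a + cnj \<tau> *s b)"
  have "cmod ?q \<le> CARD('n) * (norm (a + \<tau> *s b) * norm (a + cnj \<tau> *s b))"
    by (rule norm_qform_le)
  also have "norm (a + \<tau> *s b) * norm (a + cnj \<tau> *s b) \<le> (3 * s) * 1"
    using v[of \<tau>] v[of "cnj \<tau>"] assms s by (intro mult_mono) auto
  finally have q: "cmod ?q \<le> CARD('n) * (3 * s)" by simp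
  have "norm (qcurve P a b \<tau>) \<le> norm (a + \<tau> *s b) + cmod ?q"
    unfolding qcurve_def by (rule order_trans[OF norm_triangle_ineq]) (simp add: norm_axis_eq norm_mult)
  then show ?thesis using v[OF assms(3)] q by (simp add: algebra_simps)
qed

text \<open>
  Replacing a real parameter by complex ones leads from points of the hyperquadric to pairs that
  satisfy the polarized equation, and every such pair arises: it consists of the points with
  parameters \<open>\<i>\<close> and \<open>- \<i>\<close> of a curve which is small when the pair is.
\<close>

lemma segre_pair_on_qcurve:
  fixes x y :: "complex^('n::finite option)" and s :: real
  assumes "segre P x y" "norm x \<le> s" "norm y \<le> s"
  obtains a b where "Im (a $ None) = 0" "Im (b $ None) = 0" "qcurve P a b \<i> = x" "qcurve P a b (- \<i>) = y"
    "norm a \<le> (real CARD('n) + 1) * s" "norm b \<le> (real CARD('n) + 1) * s"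
proof
  define a where "a = (\<chi> k. case k of Some \<alpha> \<Rightarrow> (x $ Some \<alpha> + y $ Some \<alpha>) / 2
      | None \<Rightarrow> of_real (Re ((x $ None + cnj (y $ None)) / 2)))"
  define b where "b = (\<chi> k. case k of Some \<alpha> \<Rightarrow> (x $ Some \<alpha> - y $ Some \<alpha>) / (2 * \<i>)
      | None \<Rightarrow> of_real (Im ((x $ None + cnj (y $ None)) / 2)))"
  show "Im (a $ None) = 0" "Im (b $ None) = 0" by (simp_all add: a_def b_def)
  have S: "(a + \<i> *s b) $ Some \<alpha> = x $ Some \<alpha>" "(a - \<i> *s b) $ Some \<alpha> = y $ Some \<alpha>" for \<alpha>
    by (simp_all add: a_def b_def field_simps)
  have N: "(a + \<i> *s b) $ None = (x $ None + cnj (y $ None)) / 2"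
       "(a - \<i> *s b) $ None = (y $ None + cnj (x $ None)) / 2"
    by (simp_all add: a_def b_def complex_eq_iff diff_divide_distrib)
  have q: "qform P (a + \<i> *s b) (a - \<i> *s b) = qform P x y"
    "qform P (a - \<i> *s b) (a + \<i> *s b) = qform P y x"
    unfolding qform_def S by simp_all
  have xy: "x $ None - cnj (y $ None) = 2 * \<i> * qform P x y" using assms(1) by (simp add: segre_def)
  have yx: "cnj (x $ None) - y $ None = - 2 * \<i> * qform P y x"
    using arg_cong[OF xy, of cnj] by (simp add: cnj_qform)
  have xy': "\<i> * qform P x y = (x $ None - cnj (y $ None)) / 2"
    and yx': "\<i> * qform P y x = (y $ None - cnj (x $ None)) / 2"
    using xy yx by (simp_all add: field_simps)
  have cN: "(a + \<i> *s b) $ None + \<i> * qform P x y = x $ None"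
    "(a - \<i> *s b) $ None + \<i> * qform P y x = y $ None"
    unfolding N xy' yx' by (simp_all add: field_simps)
  have cx: "qcurve P a b \<i> = (a + \<i> *s b) + axis None (\<i> * qform P (a + \<i> *s b) (a - \<i> *s b))"
    and cy: "qcurve P a b (-\<i>) = (a - \<i> *s b) + axis None (\<i> * qform P (a - \<i> *s b) (a + \<i> *s b))"
    by (simp_all only: qcurve_def complex_cnj_i complex_cnj_minus minus_minus vector_smult_lneg
         diff_conv_add_uminus)
  show "qcurve P a b \<i> = x"
  proof (subst vec_eq_iff, intro allI)
    fix k
    show "qcurve P a b \<i> $ k = x $ k"
      unfolding cx q vector_add_component
      using cN(1) S(1) by (cases k) (simp_all add: axis_def)
  qed
  show "qcurve P a b (- \<i>) = y"
  proof (subst vec_eq_iff, intro allI)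
    fix k
    show "qcurve P a b (- \<i>) $ k = y $ k"
      unfolding cy q vector_add_component
      using cN(2) S(2) by (cases k) (simp_all add: axis_def)
  qed
  have xk: "cmod (x $ k) \<le> s" and yk: "cmod (y $ k) \<le> s" for k
    using assms Finite_Cartesian_Product.norm_nth_le order_trans by blast+
  have nrm: "norm v \<le> (real CARD('n) + 1) * s" if "\<And>k. cmod (v $ k) \<le> s" for v :: "complex^('n option)"
  proof -
    have "norm v \<le> (\<Sum>k\<in>(UNIV :: 'n option set). cmod (v $ k))"
      unfolding norm_vec_def by (rule L2_set_le_sum) simp
    also have "\<dots> \<le> (\<Sum>k\<in>(UNIV :: 'n option set). s)" by (intro sum_mono that)
    finally show ?thesis by (simp add: card_option add.commute)
  qed
  have avg: "cmod ((u + v) / 2) \<le> s" if "cmod u \<le> s" "cmod v \<le> s" for u v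
    using norm_triangle_ineq[of u v] that by (simp add: norm_divide)
  show "norm a \<le> (real CARD('n) + 1) * s"
  proof (rule nrm)
    fix k
    have "cmod (a $ None) \<le> cmod ((x $ None + cnj (y $ None)) / 2)"
      unfolding a_def vec_lambda_beta option.case norm_of_real by (rule abs_Re_le_cmod)
    then show "cmod (a $ k) \<le> s"
      using avg[OF xk[of k] yk[of k]] avg[of "x $ None" "cnj (y $ None)"] xk[of None] yk[of None]
      by (cases k) (auto simp: a_def)
  qed
  show "norm b \<le> (real CARD('n) + 1) * s"
  proof (rule nrm)
    fix k
    have "cmod (b $ None) \<le> cmod ((x $ None + cnj (y $ None)) / 2)"
      unfolding b_def vec_lambda_beta option.case norm_of_real by (rule abs_Im_le_cmod)
    then show "cmod (b $ k) \<le> s"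
      using avg[of "x $ k" "- (y $ k)"] avg[of "x $ None" "cnj (y $ None)"] xk[of k] yk[of k]
        xk[of None] yk[of None]
      by (cases k) (auto simp: b_def norm_divide norm_mult)
  qed
qed

text \<open>
  As functions of the parameter both sides are holomorphic, because the second factors are conjugated
  twice. So the identity spreads from the real axis.
\<close>

lemma hermitian_identity:
  assumes F: "\<And>k. (\<lambda>\<tau>. F \<tau> $ k) holomorphic_on S" and d: "d holomorphic_on S"
    and S: "open S" "connected S" "cnj ` S \<subseteq> S" "0 \<in> S" "w \<in> S"
    and e: "e > 0" "\<And>t::real. \<bar>t\<bar> < e \<Longrightarrow>
      cdot (F (of_real t)) (F (of_real t)) = d (of_real t) * cnj (d (of_real t))"
  shows "cdot (F w) (F (cnj w)) = d w * cnj (d (cnj w))"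
proof -
  have "cnj ` S = S" using S(3) by (metis complex_cnj_cnj image_eqI image_subset_iff subsetI subset_antisym)
  then have conj: "(\<lambda>\<tau>. cnj (h (cnj \<tau>))) holomorphic_on S" if "h holomorphic_on S" for h
    using holomorphic_on_compose_cnj_cnj[of h S] that S(1) by (simp add: o_def)
  let ?h = "\<lambda>\<tau>. cdot (F \<tau>) (F (cnj \<tau>)) - d \<tau> * cnj (d (cnj \<tau>))"
  have "?h holomorphic_on S"
    unfolding cdot_def by (intro holomorphic_intros F d conj)
  then have "?h w = 0"
    by (rule real_axis_identity[OF _ S(1,2,4,5) e(1)]) (use e(2) in auto)
  then show ?thesis by simp
qed

text \<open>
  Join \<open>x\<close> and \<open>y\<close> by the curve of \<open>segre_pair_on_qcurve\<close>. For real parameters the two arguments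
  \<open>qcurve P a b \<tau>\<close> and \<open>qcurve P a b (cnj \<tau>)\<close> agree and lie on the hyperquadric, where the equation is
  given; \<open>hermitian_identity\<close> carries it to the parameter \<open>\<i>\<close>. The radius \<open>r\<close> is so small that the curve
  remains in the domain of \<open>f\<close> for parameters of modulus less than 2.
\<close>

lemma polarization:
  fixes f :: "complex^('n::finite option) \<Rightarrow> complex^'k"
  assumes f: "holomorphic_map_on f (ball 0 R)" and R: "R > 0"
    and sph: "\<And>x. x \<in> ball 0 R \<inter> real_hyperquadric P \<Longrightarrow> cdot (f x) (f x) = 1"
  obtains r where "r > 0" "r \<le> R"
    "\<And>x y. norm x < r \<Longrightarrow> norm y < r \<Longrightarrow> segre P x y \<Longrightarrow> cdot (f x) (f y) = 1"
proof -
  define K where "K = real CARD('n) + 1"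
  define s where "s = min 1 (R / (2 * K)) / 3"
  define r where "r = s / K"
  have K: "K \<ge> 1" by (simp add: K_def)
  have s: "s > 0" "3 * s \<le> 1" "K * (3 * s) \<le> R / 2"
  proof -
    have "3 * s \<le> R / (2 * K)" by (simp add: s_def)
    then show "K * (3 * s) \<le> R / 2" using K by (simp add: field_simps)
  qed (use K R in \<open>auto simp: s_def\<close>)
  have Kr: "K * r = s" using K by (simp add: r_def)
  show thesis
  proof
    show "r > 0" using s K by (simp add: r_def)
    have "3 * s \<le> K * (3 * s)" using mult_right_mono[OF K, of "3 * s"] s by simp
    then have "s \<le> R" using s R by linarith
    moreover have "r \<le> s" using s K by (simp add: r_def field_simps)
    ultimately show "r \<le> R" by simp
    fix x y :: "complex^('n option)"
    assume xy: "norm x < r" "norm y < r" "segre P x y"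
    obtain a b where ab: "Im (a $ None) = 0" "Im (b $ None) = 0"
        "qcurve P a b \<i> = x" "qcurve P a b (- \<i>) = y" "norm a \<le> s" "norm b \<le> s"
      using segre_pair_on_qcurve[OF xy(3), of r] xy(1,2) Kr unfolding K_def
      by (metis less_imp_le)
    have c: "qcurve P a b \<tau> \<in> ball 0 R" if "\<tau> \<in> ball 0 2" for \<tau>
    proof -
      have "norm (qcurve P a b \<tau>) \<le> K * (3 * s)"
        using norm_qcurve_le[OF ab(5,6) _ s(2), of \<tau> P] that by (simp add: K_def add.commute)
      with s(3) R show ?thesis by simp
    qed
    have "cdot (f (qcurve P a b \<i>)) (f (qcurve P a b (cnj \<i>))) = 1 * cnj 1"
    proof (rule hermitian_identity[where F = "\<lambda>\<tau>. f (qcurve P a b \<tau>)" and d = "\<lambda>_. 1" and S = "ball 0 2" and e = 1])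
      show "(\<lambda>\<tau>. f (qcurve P a b \<tau>) $ k) holomorphic_on ball 0 2" for k
      proof (rule holomorphic_on_compose_curve[where c = "qcurve P a b"])
        show "holomorphic_fun_on (\<lambda>x. f x $ k) (ball 0 R)"
          using f by (simp add: holomorphic_map_on_iff_components)
      qed (use c in \<open>blast intro: qcurve_holomorphic\<close>)+
      show "cdot (f (qcurve P a b (of_real t))) (f (qcurve P a b (of_real t))) = 1 * cnj 1" if "\<bar>t\<bar> < 1" for t
        using sph[of "qcurve P a b (of_real t)"] c[of "of_real t"] that
          qcurve_in_hyperquadric[OF ab(1,2), of P t] by auto
    qed auto
    then show "cdot (f x) (f y) = 1" using ab by simp
  qed
qed

section \<open>Heisenberg translations\<close>

text \<open>
  Left translation in the Heisenberg group, extended to the ambient space: an affine automorphism of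
  the hyperquadric that takes the origin to \<open>p\<close>.
\<close>

definition qtranslate :: "'n::finite set \<Rightarrow> complex^('n option) \<Rightarrow> complex^('n option) \<Rightarrow>
    complex^('n option)" where
  "qtranslate P p x = x + p + axis None (2 * \<i> * qform P x p)"

lemma qtranslate_0 [simp]: "qtranslate P p 0 = p"
  by (simp add: qtranslate_def axis_def vec_eq_iff)

lemma holomorphic_qform_left: "holomorphic_fun_on (\<lambda>x. qform P x p) U"
  unfolding qform_def by (intro holomorphic_fun_intros)

lemma holomorphic_qtranslate: "holomorphic_map_on (qtranslate P p) U"
  unfolding holomorphic_map_on_iff_components
proof
  fix k
  have "(\<lambda>x. qtranslate P p x $ k) = (\<lambda>x. x $ k + (p $ k + (if k = None then 2 * \<i> else 0) * qform P x p))"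
    by (auto simp: fun_eq_iff qtranslate_def axis_def)
  moreover have "holomorphic_fun_on \<dots> U"
    by (intro holomorphic_fun_intros holomorphic_qform_left)
  ultimately show "holomorphic_fun_on (\<lambda>x. qtranslate P p x $ k) U" by simp
qed

lemma qtranslate_in_hyperquadric_iff:
  assumes p: "p \<in> real_hyperquadric P"
  shows "qtranslate P p x \<in> real_hyperquadric P \<longleftrightarrow> x \<in> real_hyperquadric P"
proof -
  have "Re (qform P p x) = Re (qform P x p)"
    using arg_cong[OF cnj_qform[of P x p], of Re] by simp
  moreover have "Im (p $ None) = Re (qform P p p)" using p by (simp add: in_hyperquadric_iff)
  ultimately show ?thesis
    by (simp add: in_hyperquadric_iff qtranslate_def)
qed

lemma qtranslate_inverse:
  assumes p: "p \<in> real_hyperquadric P"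
  obtains q where "q \<in> real_hyperquadric P" "\<And>x. qtranslate P p (qtranslate P q x) = x"
    "\<And>x. qtranslate P q (qtranslate P p x) = x"
proof
  define q where "q = (- p) + axis None (p $ None - cnj (p $ None))"
  have e: "p $ None - cnj (p $ None) = 2 * \<i> * qform P p p"
    using p by (simp add: in_hyperquadric_iff_segre segre_def)
  show "q \<in> real_hyperquadric P"
    using p by (simp add: in_hyperquadric_iff q_def)
  show "qtranslate P p (qtranslate P q x) = x" for x
    unfolding q_def e qtranslate_def by (simp, simp add: vec_eq_iff axis_def right_diff_distrib)
  show "qtranslate P q (qtranslate P p x) = x" for x
    unfolding q_def e qtranslate_def by (simp, simp add: vec_eq_iff axis_def right_diff_distrib)
qed

lemma biholomorphic_qtranslate:
  assumes p: "p \<in> real_hyperquadric P"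
  shows "biholomorphic_on (qtranslate P p) UNIV" "range (qtranslate P p) = UNIV"
proof -
  obtain q where q: "\<And>x. qtranslate P p (qtranslate P q x) = x"
    "\<And>x. qtranslate P q (qtranslate P p x) = x"
    using qtranslate_inverse[OF p] by metis
  show r: "range (qtranslate P p) = UNIV" using q(1) by (metis surjI)
  show "biholomorphic_on (qtranslate P p) UNIV"
    by (rule biholomorphic_onI[of _ _ "qtranslate P q"]) (simp_all add: r q holomorphic_qtranslate)
qed

section \<open>Complex-linear maps and derivatives\<close>

definition complex_linear :: "(complex^'m \<Rightarrow> complex^'k) \<Rightarrow> bool" where
  "complex_linear D \<longleftrightarrow> linear D \<and> (\<forall>c x. D (c *s x) = c *s D x)"

definition complex_functional :: "(complex^'m \<Rightarrow> complex) \<Rightarrow> bool" where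
  "complex_functional A \<longleftrightarrow> linear A \<and> (\<forall>c x. A (c *s x) = c * A x)"

lemma scaleR_eq_vector_smult: "t *\<^sub>R (x :: complex^'m) = of_real t *s x"
  by (simp add: vec_eq_iff, simp add: scaleR_conv_of_real)

lemma complex_functionalI:
  assumes "\<And>x y. A (x + y) = A x + A y" "\<And>c x. A (c *s x) = c * A x"
  shows "complex_functional A"
  using assms unfolding complex_functional_def
  by (auto intro!: linearI simp: scaleR_eq_vector_smult scaleR_conv_of_real)

lemma complex_linearD:
  assumes "complex_linear D"
  shows "D (x + y) = D x + D y" "D (x - y) = D x - D y" "D (c *s x) = c *s D x" "D 0 = 0"
    "bounded_linear D"
  using assms by (auto simp: complex_linear_def linear_add linear_diff linear_0
      linear_conv_bounded_linear)

lemma complex_functionalD: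
  assumes "complex_functional A"
  shows "A (x + y) = A x + A y" "A (x - y) = A x - A y" "A (c *s x) = c * A x" "A 0 = 0"
    "bounded_linear A"
  using assms by (auto simp: complex_functional_def linear_add linear_diff linear_0
      linear_conv_bounded_linear)

lemma holomorphic_complex_linear:
  assumes "complex_linear D" shows "holomorphic_map_on D U"
  unfolding holomorphic_map_on_def
  by (intro ballI exI[of _ D] conjI bounded_linear_imp_has_derivative)
     (simp_all add: complex_linearD[OF assms])

lemma holomorphic_complex_functional:
  assumes "complex_functional A" shows "holomorphic_fun_on A U"
  unfolding holomorphic_fun_on_def
  by (intro ballI exI[of _ A] conjI bounded_linear_imp_has_derivative)
     (simp_all add: complex_functionalD[OF assms])

lemma biholomorphic_derivative:
  assumes f: "biholomorphic_on f W" and x: "x \<in> W"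
  obtains D E where "(f has_derivative D) (at x)" "complex_linear D" "complex_linear E"
    "\<And>v. E (D v) = v" "\<And>v. D (E v) = v"
proof -
  let ?g = "inv_into W f"
  obtain D where D: "(f has_derivative D) (at x)" "\<And>c v. D (c *s v) = c *s D v"
    using f x by (auto simp: biholomorphic_on_def holomorphic_map_on_def)
  obtain E where E: "(?g has_derivative E) (at (f x))" "\<And>c v. E (c *s v) = c *s E v"
    using f x by (auto simp: biholomorphic_on_def holomorphic_map_on_def)
  have gf: "?g (f x) = x" using f x by (auto simp: biholomorphic_on_def)
  have "((\<lambda>y. ?g (f y)) has_derivative (\<lambda>v. E (D v))) (at x)"
    by (rule has_derivative_compose[OF D(1) E(1)])
  moreover have "((\<lambda>y. ?g (f y)) has_derivative (\<lambda>v. v)) (at x)"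
    by (rule has_derivative_transform_within_open[OF has_derivative_ident _ x])
      (use f in \<open>auto simp: biholomorphic_on_def\<close>)
  ultimately have ED: "(\<lambda>v. E (D v)) = (\<lambda>v. v)" by (rule has_derivative_unique)
  have "((\<lambda>y. f (?g y)) has_derivative (\<lambda>v. D (E v))) (at (f x))"
    by (rule has_derivative_compose[OF E(1)]) (use gf D(1) in simp)
  moreover have "((\<lambda>y. f (?g y)) has_derivative (\<lambda>v. v)) (at (f x))"
    by (rule has_derivative_transform_within_open[OF has_derivative_ident, of "f ` W"])
      (use f x in \<open>auto simp: biholomorphic_on_def f_inv_into_f\<close>)
  ultimately have DE: "(\<lambda>v. D (E v)) = (\<lambda>v. v)" by (rule has_derivative_unique)
  show thesis
  proof
    show "complex_linear D" "complex_linear E"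
      using D E by (auto simp: complex_linear_def has_derivative_linear)
  qed (use D(1) ED DE in \<open>auto simp: fun_eq_iff\<close>)
qed

section \<open>Maps of a hyperquadric into the sphere are projective\<close>

lemma segre_0_left [simp]: "segre P 0 y \<longleftrightarrow> y $ None = 0"
  by (simp add: segre_def)

text \<open>
  The kernel of \<open>\<Lambda>\<close> contains the hyperplane \<open>segre P X y\<close>, which determines \<open>\<Lambda>\<close> up to a factor.
\<close>

lemma segre_functional:
  assumes \<Lambda>: "complex_functional \<Lambda>" and van: "\<And>X. segre P X y \<Longrightarrow> \<Lambda> X = 0" and y: "y $ None = 0"
  shows "\<Lambda> X = \<Lambda> (axis None 1) * (X $ None - 2 * \<i> * qform P X y)"
proof -
  define s where "s = X $ None - 2 * \<i> * qform P X y"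
  have "segre P (X - s *s axis None 1) y"
    by (simp add: segre_def y s_def)
  from van[OF this] show ?thesis
    by (simp add: complex_functionalD[OF \<Lambda>] s_def algebra_simps)
qed

lemma complex_functional_cdot:
  assumes "complex_linear D" shows "complex_functional (\<lambda>X. cdot (D X) y)"
  by (rule complex_functionalI) (simp_all add: complex_linearD[OF assms])

text \<open>
  The function \<open>\<lambda>x. cdot (f x) (f y)\<close> is constant on the Segre variety of \<open>y\<close>. If the last coordinate of
  \<open>y\<close> is zero, this variety is a linear subspace, and the derivative at the origin vanishes on it.
\<close>

lemma segre_tangent_vanishing:
  assumes D: "(f has_derivative D) (at 0)" "complex_linear D" and r: "r > 0" and y: "norm y < r" "y $ None = 0"
    and S: "\<And>x y. norm x < r \<Longrightarrow> norm y < r \<Longrightarrow> segre P x y \<Longrightarrow> cdot (f x) (f y) = 1"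
    and X: "segre P X y"
  shows "cdot (D X) (f y) = 0"
proof -
  have lin: "bounded_linear (\<lambda>v. cdot v (f y))"
    by (intro complex_functionalD(5) complex_functionalI) simp_all
  have t: "((\<lambda>t. t *\<^sub>R X) has_derivative (\<lambda>t. t *\<^sub>R X)) (at 0)"
    by (intro bounded_linear_imp_has_derivative bounded_linear_scaleR_left)
  have "((\<lambda>t::real. f (t *\<^sub>R X)) has_derivative (\<lambda>t. D (t *\<^sub>R X))) (at 0)"
    by (rule has_derivative_compose[OF t]) (use D in simp)
  from bounded_linear.has_derivative[OF lin this]
  have d: "((\<lambda>t::real. cdot (f (t *\<^sub>R X)) (f y)) has_derivative (\<lambda>t. cdot (D (t *\<^sub>R X)) (f y))) (at 0)" .
  have "((\<lambda>t. t *\<^sub>R X) \<longlongrightarrow> 0 *\<^sub>R X) (nhds (0::real))"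
    by (intro tendsto_intros filterlim_ident)
  then have "\<forall>\<^sub>F t in nhds (0::real). t *\<^sub>R X \<in> ball 0 r"
    by (rule topological_tendstoD) (use r in auto)
  then obtain T where T: "open T" "0 \<in> T" "\<And>t. t \<in> T \<Longrightarrow> norm (t *\<^sub>R X) < r"
    by (auto simp: eventually_nhds simp del: norm_scaleR)
  have "((\<lambda>t::real. cdot (f (t *\<^sub>R X)) (f y)) has_derivative (\<lambda>t. 0)) (at 0)"
  proof (rule has_derivative_transform_within_open[of "\<lambda>_. 1" _ 0 _ T])
    show "1 = cdot (f (t *\<^sub>R X)) (f y)" if "t \<in> T" for t
    proof -
      have "segre P (t *\<^sub>R X) y"
        using X y(2) by (simp add: segre_def scaleR_eq_vector_smult)
      then show ?thesis using S[OF T(3)[OF that] y(1)] by simp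
    qed
  qed (use T in auto)
  from has_derivative_unique[OF d this] have "cdot (D (1 *\<^sub>R X)) (f y) = 0" by meson
  then show ?thesis by simp
qed

text \<open>
  Three steps lead to the projective form. First, with \<open>\<psi> x = E (f x - f 0)\<close>, so that \<open>\<psi>\<close> has the identity
  as derivative at the origin, \<open>\<psi>\<close> maps a neighbourhood of the origin in the Segre
  variety of \<open>y\<close> into that variety if \<open>y $ None = 0\<close>. Secondly,
  varying \<open>y\<close>, it preserves complex lines through the origin, so \<open>x = m x *s \<psi> x\<close>. Thirdly, the polarized
  equation, multiplied by \<open>m x * cnj (m y)\<close>, becomes linear in \<open>m\<close>. Evaluated at pairs with
  \<open>y\<close> on the last axis it shows that \<open>m\<close> is linear up to a function of the last
  coordinate; evaluated at pairs in a coordinate plane it shows that \<open>m\<close> is affine on the last axis.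
\<close>

lemma sphere_map_locally_projective:
  fixes f :: "complex^('n::finite option) \<Rightarrow> complex^('n option)"
  assumes f: "biholomorphic_on f W" and W: "0 \<in> W"
    and sph: "\<And>x. x \<in> W \<inter> real_hyperquadric P \<Longrightarrow> cdot (f x) (f x) = 1"
  obtains D E A b where "complex_linear D" "complex_linear E" "\<And>v. E (D v) = v" "\<And>v. D (E v) = v"
    "complex_functional A" "b \<noteq> 0"
    "\<forall>\<^sub>F x in nhds 0. (b + A x) *s (f x - f 0) = D x"
proof -
  obtain R where R: "R > 0" "ball 0 R \<subseteq> W"
    using f W by (auto simp: biholomorphic_on_def open_contains_ball)
  have hol: "holomorphic_map_on f (ball 0 R)"
    using f R by (auto simp: biholomorphic_on_def elim: holomorphic_map_on_subset)
  obtain r where r: "r > 0" "r \<le> R"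
    and S: "\<And>x y. norm x < r \<Longrightarrow> norm y < r \<Longrightarrow> segre P x y \<Longrightarrow> cdot (f x) (f y) = 1"
    using polarization[OF hol R(1), of P] sph R(2) by blast
  obtain D E where D: "(f has_derivative D) (at 0)" "complex_linear D" and E: "complex_linear E"
    and ED: "\<And>v. E (D v) = v" and DE: "\<And>v. D (E v) = v"
    by (rule biholomorphic_derivative[OF f W]) blast
  note Dl = complex_linearD(1-4)[OF D(2)] and El = complex_linearD(1-4)[OF E]
  define \<psi> where "\<psi> = (\<lambda>x. E (f x - f 0))"
  have D\<psi>: "D (\<psi> x) = f x - f 0" for x by (simp add: \<psi>_def DE)
  have hol\<psi>: "holomorphic_fun_on (\<lambda>x. \<psi> x $ k) (ball 0 r)" for k
  proof -
    have "holomorphic_map_on (\<lambda>x. f x - f 0) (ball 0 r)"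
      using holomorphic_map_on_subset[OF hol subset_ball[OF r(2)]]
      by (auto simp: holomorphic_map_on_iff_components intro!: holomorphic_fun_intros)
    then have "holomorphic_map_on \<psi> (ball 0 r)"
      unfolding \<psi>_def by (rule holomorphic_map_on_compose[OF holomorphic_complex_linear[OF E, of UNIV]]) auto
    then show ?thesis by (simp add: holomorphic_map_on_iff_components)
  qed
  have \<psi>0: "\<psi> x \<noteq> 0" if "norm x < r" "x \<noteq> 0" for x
  proof
    assume "\<psi> x = 0"
    then have "f x = f 0" using D\<psi>[of x] by (simp add: Dl)
    moreover have "x \<in> W" using that r R by (auto simp: subset_iff)
    ultimately show False using f W that by (auto simp: biholomorphic_on_def inj_on_def)
  qed
  define ew :: "complex^('n option)" where "ew = axis None 1"
  have ew: "ew $ None = 1" "ew $ Some \<alpha> = 0" "norm (c *s ew) = cmod c" "qform P x (c *s ew) = 0" "qform P (c *s ew) x = 0"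
    "qform P x ew = 0" "qform P ew x = 0" for \<alpha> c x
    by (simp_all add: ew_def norm_vector_smult norm_axis_eq) (simp_all add: axis_def)

  \<comment> \<open>If \<open>y $ None = 0\<close>, the functional \<open>\<lambda>X. cdot (D X) (f y)\<close> has the Segre variety of \<open>y\<close> as its kernel.
     It kills \<open>\<psi> x\<close> for all \<open>x\<close> in that variety, as \<open>D (\<psi> x) = f x - f 0\<close>.\<close>
  have \<Lambda>: "cdot (D X) (f y) = cdot (D ew) (f y) * (X $ None - 2 * \<i> * qform P X y)"
    and \<Lambda>0: "cdot (D ew) (f y) \<noteq> 0" if y: "norm y < r" "y $ None = 0" for X y
  proof -
    show *: "cdot (D X) (f y) = cdot (D ew) (f y) * (X $ None - 2 * \<i> * qform P X y)" for X
      unfolding ew_def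
      by (rule segre_functional[OF complex_functional_cdot[OF D(2)] _ y(2)])
        (rule segre_tangent_vanishing[OF D r(1) y S])
    show "cdot (D ew) (f y) \<noteq> 0"
    proof
      assume "cdot (D ew) (f y) = 0"
      with *[of "E (f y)"] have "f y = 0" by (simp add: DE)
      moreover have "cdot (f 0) (f y) = 1" using S[of 0 y] y r by simp
      ultimately show False by simp
    qed
  qed
  define c where "c = cdot (D ew) (f 0)"
  have c: "c \<noteq> 0" "cdot (D X) (f 0) = c * X $ None" for X
    using \<Lambda>[of 0 X] \<Lambda>0[of 0] r by (simp_all add: c_def)
  have c': "cdot (f 0) (D X) = cnj c * cnj (X $ None)" for X
    using arg_cong[OF c(2)[of X], of cnj] by (simp add: cnj_cdot)
  have seg: "\<psi> x $ None = 2 * \<i> * qform P (\<psi> x) y"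
    if "norm x < r" "norm y < r" "y $ None = 0" "segre P x y" for x y
  proof -
    have "cdot (D (\<psi> x)) (f y) = cdot (f x) (f y) - cdot (f 0) (f y)" by (simp add: D\<psi>)
    also have "\<dots> = 0" using S[of x y] S[of 0 y] that r by simp
    finally show ?thesis using \<Lambda>[OF that(2,3), of "\<psi> x"] \<Lambda>0[OF that(2,3)] by simp
  qed

  \<comment> \<open>The Segre varieties used here are those of the points \<open>y\<close> on the axis of \<open>\<alpha>\<close>. Such a \<open>y\<close> with \<open>x\<close> in its
     variety is small only if \<open>x $ None\<close> is small compared with \<open>x $ Some \<alpha>\<close>; the identity theorem takes
     care of the other \<open>x\<close>.\<close>
  have radial: "x $ Some \<alpha> * \<psi> x $ None = x $ None * \<psi> x $ Some \<alpha>" if "norm x < r" for x \<alpha>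
  proof -
    define g where "g = (\<lambda>x. x $ Some \<alpha> * \<psi> x $ None - x $ None * \<psi> x $ Some \<alpha>)"
    have "g x = 0"
    proof (rule holomorphic_fun_identity[of g "ball 0 r" "axis (Some \<alpha>) (of_real (r/2))"])
      show "holomorphic_fun_on g (ball 0 r)"
        unfolding g_def by (intro holomorphic_fun_intros hol\<psi>)
      show "(axis (Some \<alpha>) (of_real (r/2)) :: complex^('n option)) \<in> ball 0 r" using r by (simp add: norm_axis_eq)
      let ?O = "{x :: complex^('n option). norm x < r} \<inter> {x. cmod (x $ None) < 2 * r * cmod (x $ Some \<alpha>)}"
      have "open ?O"
        by (intro open_Int open_Collect_less continuous_intros)
      moreover have "axis (Some \<alpha>) (of_real (r/2)) \<in> ?O"
        using r by (simp add: norm_axis_eq, simp add: axis_def)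
      moreover have "g x = 0" if "x \<in> ?O" for x
      proof -
        define e :: complex where "e = (if \<alpha> \<in> P then 1 else -1)"
        have e: "e * e = 1" "cmod e = 1" by (auto simp: e_def)
        have x\<alpha>: "x $ Some \<alpha> \<noteq> 0" using that by auto
        \<comment> \<open>\<open>t\<close> solves \<open>segre P x (axis (Some \<alpha>) t)\<close>; \<open>e\<close> is its own inverse\<close>
        define t where "t = cnj (x $ None * e / (2 * \<i> * x $ Some \<alpha>))"
        have ct: "2 * \<i> * (e * (u * cnj t)) = u * x $ None / x $ Some \<alpha>" for u
        proof -
          have "2 * \<i> * (e * (u * cnj t)) = (e * e) * (u * x $ None / x $ Some \<alpha>)"
            using x\<alpha> by (simp add: t_def field_simps)
          then show ?thesis by (simp add: e)
        qed
        have "norm (axis (Some \<alpha>) t :: complex^('n option)) < r"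
          using that x\<alpha> by (simp add: norm_axis_eq t_def norm_mult norm_divide e field_simps)
        moreover have "segre P x (axis (Some \<alpha>) t)"
          using ct[of "x $ Some \<alpha>"] x\<alpha> by (simp add: segre_def e_def[symmetric]) (simp add: axis_def)
        ultimately have "\<psi> x $ None = 2 * \<i> * qform P (\<psi> x) (axis (Some \<alpha>) t)"
          using that by (intro seg) (auto simp: axis_def)
        also have "\<dots> = \<psi> x $ Some \<alpha> * x $ None / x $ Some \<alpha>"
          using ct by (simp add: e_def[symmetric])
        finally show "g x = 0" using x\<alpha> by (simp add: g_def)
      qed
      ultimately show "\<forall>\<^sub>F x in nhds (axis (Some \<alpha>) (of_real (r/2))). g x = 0"
        unfolding eventually_nhds by blast
    qed (use that r in auto)
    then show ?thesis by (simp add: g_def)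
  qed
  \<comment> \<open>\<open>m\<close> carries information only where \<open>x $ None \<noteq> 0\<close>; the formula obtained for it there is extended at the end.\<close>
  define m where "m x = x $ None / \<psi> x $ None" for x
  have m: "x = m x *s \<psi> x" if "norm x < r" "x $ None \<noteq> 0" for x
  proof -
    have "\<psi> x $ None \<noteq> 0"
    proof
      assume 0: "\<psi> x $ None = 0"
      then have "\<psi> x $ Some \<alpha> = 0" for \<alpha> using radial[OF that(1), of \<alpha>] that(2) by simp
      with 0 have "\<psi> x = 0" unfolding vec_eq_iff by (metis option.exhaust zero_index)
      moreover have "x \<noteq> 0" using that(2) by auto
      ultimately show False using \<psi>0 that(1) by blast
    qed
    then show ?thesis
      unfolding vec_eq_iff m_def
    proof (intro allI)
      fix k show "x $ k = (x $ None / \<psi> x $ None *s \<psi> x) $ k"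
        using radial[OF that(1)] \<open>\<psi> x $ None \<noteq> 0\<close> by (cases k) (auto simp: field_simps)
    qed
  qed
  define h where "h x y = cdot (D x) (D y)" for x y
  have h: "h (x + x') y = h x y + h x' y" "h x (y + y') = h x y + h x y'" "h (x - x') y = h x y - h x' y"
    "h (u *s x) y = u * h x y" "h x (u *s y) = cnj u * h x y" "cnj (h x y) = h y x" for x x' y y' u
    by (simp_all add: h_def Dl cnj_cdot)
  have main: "c * x $ None * cnj (m y) + cnj c * cnj (y $ None) * m x + h x y = 0"
    if "norm x < r" "norm y < r" "x $ None \<noteq> 0" "y $ None \<noteq> 0" "segre P x y" for x y
  proof -
    have fx: "f x = f 0 + D (\<psi> x)" for x by (simp add: D\<psi>)
    have "1 = cdot (f 0 + D (\<psi> x)) (f 0 + D (\<psi> y))"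
      using S[OF that(1,2,5)] fx[of x] fx[of y] by simp
    then have "0 = c * \<psi> x $ None + cnj c * cnj (\<psi> y $ None) + h (\<psi> x) (\<psi> y)"
      using S[of 0 0] r by (simp add: c c' h_def add.assoc)
    then have "0 = m x * cnj (m y) * (c * \<psi> x $ None + cnj c * cnj (\<psi> y $ None) + h (\<psi> x) (\<psi> y))"
      by simp
    also have "\<dots> = c * (m x *s \<psi> x) $ None * cnj (m y) + cnj c * cnj ((m y *s \<psi> y) $ None) * m x
        + h (m x *s \<psi> x) (m y *s \<psi> y)"
      by (simp add: h algebra_simps)
    finally show ?thesis using m that by simp
  qed

  \<comment> \<open>Both \<open>x\<close> and its projection to the last axis lie in the Segre variety of \<open>cnj w *s ew\<close>,
     where \<open>w = x $ None\<close>. The difference of the two equations is free of \<open>m (cnj w *s ew)\<close>.\<close>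
  define A0 where "A0 x = - h (x - x $ None *s ew) ew / cnj c" for x
  have m_eq: "m x = m (x $ None *s ew) + A0 x" if "norm x < r" "x $ None \<noteq> 0" for x
  proof -
    define w where "w = x $ None"
    have w: "w \<noteq> 0" "cmod w < r"
      using that Finite_Cartesian_Product.norm_nth_le[of x None] by (auto simp: w_def)
    have 1: "c * w * cnj (m (cnj w *s ew)) + cnj c * w * m x' + w * h x' ew = 0"
      if "norm x' < r" "x' $ None = w" for x'
      using main[of x' "cnj w *s ew"] that w by (simp add: ew h segre_def)
    have "w * (cnj c * m x + h x ew) = w * (cnj c * m (w *s ew) + h (w *s ew) ew)"
      using 1[of x] 1[of "w *s ew"] that w by (simp add: ew w_def[symmetric] algebra_simps) algebra
    then have "cnj c * m x + h x ew = cnj c * m (w *s ew) + h (w *s ew) ew" using w by simp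
    then show ?thesis using c(1) unfolding w_def[symmetric] A0_def h(3)
      by (simp add: field_simps)
  qed

  \<comment> \<open>Below \<open>\<rho>\<close> bounds the last coordinates of two points, and
      \<open>\<sigma>\<close>, the square root of \<open>\<rho>\<close>, their other coordinate.\<close>
  define \<sigma> where "\<sigma> = min 1 (r / 3)"
  define \<rho> where "\<rho> = \<sigma>\<^sup>2"
  have \<sigma>: "0 < \<sigma>" "\<sigma> \<le> 1" "2 * \<sigma> < r" using r by (auto simp: \<sigma>_def)
  have \<rho>: "0 < \<rho>" "\<rho> \<le> \<sigma>" "\<sigma> + \<rho> < r"
  proof -
    show "\<rho> \<le> \<sigma>" using \<sigma> by (simp add: \<rho>_def power2_eq_square mult_left_le)
    then show "\<sigma> + \<rho> < r" using \<sigma> by simp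
  qed (use \<sigma> in \<open>simp add: \<rho>_def\<close>)
  define ez :: "complex^('n option)" where "ez = axis (Some undefined) 1"
  have ez: "ez $ None = 0" "norm (u *s ez) = cmod u" for u
    by (simp_all add: ez_def norm_vector_smult norm_axis_eq) (simp_all add: axis_def)
  define e :: complex where "e = (if undefined \<in> P then 1 else -1)"
  have e: "e * e = 1" "cmod e = 1" "e \<noteq> 0" by (auto simp: e_def)
  have qez: "qform P ez ez = e" unfolding ez_def e_def by simp
  \<comment> \<open>the coefficients that result from solving \<open>main\<close> for \<open>m (w *s ew)\<close> when \<open>y $ None = \<rho>\<close> is fixed\<close>
  define b where "b = e * h ez ez / (2 * \<i> * cnj c)"
  define k where "k = - (c * cnj (m (of_real \<rho> *s ew)) + e * h ez ez / (2 * \<i>) + of_real \<rho> * h ew ew)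
      / (cnj c * of_real \<rho>)"
  have \<mu>: "m (w *s ew) = b + k * w" if w: "w \<noteq> 0" "cmod w \<le> \<rho>" for w
  proof -
    \<comment> \<open>\<open>x\<close> and \<open>y\<close> satisfy the polarized equation when the product of \<open>x\<close> and the
       conjugate of \<open>y\<close> in the direction \<open>ez\<close> is \<open>\<kappa>\<close>\<close>
    define \<kappa> where "\<kappa> = e * (w - of_real \<rho>) / (2 * \<i>)"
    define s where "s = csqrt \<kappa>"
    have ss: "s * s = \<kappa>" using power2_csqrt[of \<kappa>] by (simp add: s_def power2_eq_square)
    have "cmod s ^ 2 = cmod \<kappa>" using ss by (metis norm_power power2_eq_square)
    also have "\<dots> \<le> (cmod w + \<rho>) / 2"
      using norm_triangle_ineq4[of w "of_real \<rho>"] \<rho> by (simp add: \<kappa>_def norm_mult norm_divide e)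
    also have "\<dots> \<le> \<sigma>\<^sup>2" using w by (simp add: \<rho>_def)
    finally have s: "cmod s \<le> \<sigma>" by (rule power2_le_imp_le) (use \<sigma> in simp)
    define x where "x = s *s ez + w *s ew"
    define y where "y = cnj s *s ez + of_real \<rho> *s ew"
    have xy: "norm x < r" "norm y < r"
      using norm_triangle_ineq[of "s *s ez" "w *s ew"] norm_triangle_ineq[of "cnj s *s ez" "of_real \<rho> *s ew"]
        s w \<rho> by (simp_all add: x_def y_def ew ez)
    have xN: "x $ None = w" "y $ None = of_real \<rho>" by (simp_all add: x_def y_def ew ez)
    have "qform P x y = e * (s * s)" by (simp add: x_def y_def ew qez)
    also have "\<dots> = (e * e) * (w - of_real \<rho>) / (2 * \<i>)" unfolding ss \<kappa>_def by simp
    finally have "segre P x y" by (simp add: segre_def xN e)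
    from main[OF xy _ _ this] w \<rho>
    have eq: "c * w * cnj (m y) + cnj c * of_real \<rho> * m x + h x y = 0" by (simp add: xN)
    have mx: "cnj c * m x = cnj c * m (w *s ew) - s * h ez ew"
      using m_eq[OF xy(1)] w c(1) unfolding xN by (simp add: A0_def x_def ew ez h field_simps)
    have "cnj c * m y = cnj c * m (of_real \<rho> *s ew) - cnj s * h ez ew"
      using m_eq[OF xy(2)] \<rho> c(1) unfolding xN by (simp add: A0_def y_def ew ez h field_simps)
    from arg_cong[OF this, of cnj]
    have my: "c * cnj (m y) = c * cnj (m (of_real \<rho> *s ew)) - s * h ew ez"
      by (simp add: h)
    have hxy: "h x y = \<kappa> * h ez ez + s * of_real \<rho> * h ez ew + w * s * h ew ez + w * of_real \<rho> * h ew ew"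
      by (simp add: x_def y_def h ss[symmetric] algebra_simps)
    \<comment> \<open>the terms linear in \<open>s\<close> from \<open>A0\<close> cancel against those from \<open>h x y\<close>\<close>
    have "w * (c * cnj (m (of_real \<rho> *s ew))) + of_real \<rho> * (cnj c * m (w *s ew)) + \<kappa> * h ez ez
        + w * of_real \<rho> * h ew ew = w * (c * cnj (m y)) + of_real \<rho> * (cnj c * m x) + h x y"
      unfolding mx my hxy by (simp add: algebra_simps)
    also have "\<dots> = 0" using eq by (simp add: mult.assoc mult.commute mult.left_commute)
    finally show ?thesis
      using \<rho> c(1) unfolding b_def k_def \<kappa>_def by (simp add: field_simps)
  qed
  \<comment> \<open>this is where the target form enters: \<open>h\<close> is the pullback of a definite form\<close>
  have "h ez ez \<noteq> 0"
  proof
    assume "h ez ez = 0"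
    then have "D ez = 0" by (simp add: h_def)
    then have "ez = 0" using ED[of ez] by (simp add: El)
    then show False by (simp add: ez_def)
  qed
  then have b: "b \<noteq> 0" using e c(1) by (simp add: b_def)
  define A where "A x = k * x $ None + A0 x" for x
  have A: "complex_functional A"
  proof (rule complex_functionalI)
    show "A (u *s x) = u * A x" for u x
      by (simp add: A_def A0_def h algebra_simps)
    show "A (x + y) = A x + A y" for x y
      using c(1) by (simp add: A_def A0_def h field_simps)
  qed
  have "\<forall>\<^sub>F x in nhds 0. x \<in> ball (0 :: complex^('n option)) \<rho>"
    by (rule eventually_nhds_in_open) (use \<rho> in auto)
  then have "\<forall>\<^sub>F x in nhds 0. (b + A x) *s (f x - f 0) = D x"
  proof eventually_elim
    case (elim x)
    have sub: "ball (0 :: complex^('n option)) \<rho> \<subseteq> ball 0 r" using \<rho> \<sigma> by auto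
    \<comment> \<open>the identity theorem fills in the hyperplane \<open>x $ None = 0\<close>\<close>
    have "(b + A x) * \<psi> x $ j - x $ j = 0" for j
    proof (rule holomorphic_fun_identity[of "\<lambda>x. (b + A x) * \<psi> x $ j - x $ j" "ball 0 \<rho>" "of_real (\<rho>/2) *s ew"])
      show "holomorphic_fun_on (\<lambda>x. (b + A x) * \<psi> x $ j - x $ j) (ball 0 \<rho>)"
        by (intro holomorphic_fun_intros holomorphic_complex_functional A holomorphic_fun_on_subset[OF hol\<psi> sub])
      have "open (ball 0 \<rho> \<inter> {x :: complex^('n option). x $ None \<noteq> 0})"
        by (intro open_Int open_Collect_neq continuous_intros open_ball)
      moreover have "of_real (\<rho>/2) *s ew \<in> ball 0 \<rho> \<inter> {x. x $ None \<noteq> 0}"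
        using \<rho> ew(3)[of "of_real (\<rho>/2)"] by (simp add: ew norm_vector_smult)
      moreover have "(b + A x) * \<psi> x $ j - x $ j = 0" if x: "x \<in> ball 0 \<rho> \<inter> {x. x $ None \<noteq> 0}" for x
      proof -
        have xr: "norm x < r" "x $ None \<noteq> 0" "cmod (x $ None) \<le> \<rho>"
          using x sub Finite_Cartesian_Product.norm_nth_le[of x None] by auto
        have "m x = b + A x" using m_eq[OF xr(1,2)] \<mu>[OF xr(2,3)] by (simp add: A_def)
        then show ?thesis using m[OF xr(1,2)] by (metis cancel_comm_monoid_add_class.diff_cancel vector_smult_component)
      qed
      ultimately show "\<forall>\<^sub>F x in nhds (of_real (\<rho>/2) *s ew). (b + A x) * \<psi> x $ j - x $ j = 0"
        unfolding eventually_nhds by blast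
      then show "of_real (\<rho>/2) *s ew \<in> ball 0 \<rho>"
        using \<rho> ew(3)[of "of_real (\<rho>/2)"] by (simp add: norm_vector_smult)
    qed (use elim in auto)
    then have "(b + A x) *s \<psi> x = x" by (simp add: vec_eq_iff distrib_right)
    then have "D ((b + A x) *s \<psi> x) = D x" by simp
    then show ?case by (simp only: Dl D\<psi>)
  qed
  then show thesis using that D(2) E ED DE A b by blast
qed

section \<open>Extension of projective maps over the hyperquadric\<close>

text \<open>
  The map $x \mapsto x/(b + Ax)$ has the inverse $v \mapsto bv/(1 - Av)$, because the two denominators are
  related by $1 - Av = b/(b + Ax)$.
\<close>

lemma projective_map_biholomorphic:
  assumes D: "complex_linear D" and E: "complex_linear E" "\<And>v. E (D v) = v" "\<And>v. D (E v) = v"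
    and A: "complex_functional A" and b: "b \<noteq> 0"
  shows "biholomorphic_on (\<lambda>x. q + (1 / (b + A x)) *s D x) {x. b + A x \<noteq> 0}"
proof -
  define G where "G = (\<lambda>x. q + (1 / (b + A x)) *s D x)"
  define H where "H = (\<lambda>y. (b / (1 - A (E (y - q)))) *s E (y - q))"
  define X where "X = {x. b + A x \<noteq> 0}"
  define Y where "Y = {y. 1 - A (E (y - q)) \<noteq> 0}"
  note Dl = complex_linearD[OF D] and El = complex_linearD[OF E(1)] and Al = complex_functionalD[OF A]
  have GH: "H (G x) = x" "G x \<in> Y" if "x \<in> X" for x
  proof -
    have x: "b + A x \<noteq> 0" using that by (simp add: X_def)
    have e: "E (G x - q) = (1 / (b + A x)) *s x" by (simp add: G_def El(3) E(2))
    have a: "1 - A (E (G x - q)) = b / (b + A x)"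
      unfolding e Al(3) using x by (simp add: field_simps)
    show "G x \<in> Y" unfolding Y_def mem_Collect_eq a using x b by simp
    have "H (G x) = (b / (b / (b + A x))) *s ((1 / (b + A x)) *s x)"
      unfolding H_def by (subst a, subst e, rule refl)
    then show "H (G x) = x" using x b by simp
  qed
  have HG: "G (H y) = y" "H y \<in> X" if "y \<in> Y" for y
  proof -
    have y: "1 - A (E (y - q)) \<noteq> 0" using that by (simp add: Y_def)
    then have a: "b + A (H y) = b / (1 - A (E (y - q)))"
      unfolding H_def Al(3) by (simp add: field_simps)
    show "H y \<in> X" using a y b by (simp add: X_def)
    show "G (H y) = y" unfolding G_def a using y b by (simp add: H_def Dl(3) E(3))
  qed
  have im: "G ` X = Y"
  proof (intro equalityI subsetI)
    fix y assume "y \<in> Y" then show "y \<in> G ` X" using HG by (metis imageI)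
  qed (use GH in auto)
  have holE: "holomorphic_map_on (\<lambda>y. E (y - q)) U" for U
    by (rule holomorphic_map_on_compose[OF holomorphic_complex_linear[OF E(1), of UNIV]])
      (auto simp: holomorphic_map_on_iff_components intro!: holomorphic_fun_intros)
  have holAE: "holomorphic_fun_on (\<lambda>y. 1 - A (E (y - q))) U" for U
    by (rule holomorphic_fun_on_diff[OF holomorphic_fun_on_const])
      (rule holomorphic_fun_on_compose_map[OF holomorphic_complex_functional[OF A, of UNIV] holE], simp)
  have holA: "holomorphic_fun_on (\<lambda>x. b + A x) U" for U
    by (intro holomorphic_fun_intros holomorphic_complex_functional A)
  have "biholomorphic_on G X"
  proof (rule biholomorphic_onI[of _ _ H])
    have "open (UNIV \<inter> (\<lambda>x. b + A x) -` (- {0}))"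
      by (intro continuous_open_preimage holomorphic_fun_on_imp_continuous_on holA) auto
    moreover have "UNIV \<inter> (\<lambda>x. b + A x) -` (- {0}) = X" by (auto simp: X_def)
    ultimately show "open X" by simp
    have "open (UNIV \<inter> (\<lambda>y. 1 - A (E (y - q))) -` (- {0}))"
      by (intro continuous_open_preimage holomorphic_fun_on_imp_continuous_on holAE) auto
    moreover have "UNIV \<inter> (\<lambda>y. 1 - A (E (y - q))) -` (- {0}) = Y" by (auto simp: Y_def)
    ultimately show "open (G ` X)" by (simp add: im)
    have "holomorphic_fun_on (\<lambda>x. G x $ k) X" for k
    proof -
      have "holomorphic_fun_on (\<lambda>x. q $ k + D x $ k / (b + A x)) X"
        using holomorphic_complex_linear[OF D, of X]
        by (intro holomorphic_fun_on_add holomorphic_fun_on_const holomorphic_fun_on_divide holA)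
          (auto simp: X_def holomorphic_map_on_iff_components)
      then show ?thesis by (simp add: G_def)
    qed
    then show "holomorphic_map_on G X" by (simp add: holomorphic_map_on_iff_components)
    have "holomorphic_fun_on (\<lambda>y. H y $ k) Y" for k
    proof -
      have "holomorphic_fun_on (\<lambda>y. (b / (1 - A (E (y - q)))) * E (y - q) $ k) Y"
        using holE[of Y]
        by (intro holomorphic_fun_on_mult holomorphic_fun_on_const holomorphic_fun_on_divide holAE)
          (auto simp: Y_def holomorphic_map_on_iff_components)
      then show ?thesis by (simp add: H_def)
    qed
    then show "holomorphic_map_on H (G ` X)" by (simp add: im holomorphic_map_on_iff_components)
  qed (use GH in auto)
  then show ?thesis by (simp add: G_def X_def)
qed

lemma tendsto_qcurve: "(qcurve P a b \<longlongrightarrow> qcurve P a b t) (nhds t)"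
proof (rule vec_tendstoI)
  fix k
  have "isCont (\<lambda>\<tau>. qcurve P a b \<tau> $ k) t"
    using holomorphic_on_imp_continuous_on[OF qcurve_holomorphic[of P a b k UNIV]]
    by (simp add: continuous_on_eq_continuous_at)
  then show "((\<lambda>\<tau>. qcurve P a b \<tau> $ k) \<longlongrightarrow> qcurve P a b t $ k) (nhds t)"
    by (simp add: isCont_def tendsto_nhds_iff)
qed

lemma qcurve_from_0:
  assumes "q \<in> real_hyperquadric P"
  obtains b where "Im (b $ None) = 0" "qcurve P 0 b 0 = 0" "qcurve P 0 b 1 = q"
proof
  define b where "b = q - axis None (\<i> * qform P q q)"
  have "\<i> * qform P q q = \<i> * Im (q $ None)"
    using assms by (simp add: in_hyperquadric_iff complex_eq_iff)
  then show "Im (b $ None) = 0" by (simp add: b_def axis_def)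
  show "qcurve P 0 b 0 = 0" by (simp add: qcurve_def axis_def vec_eq_iff)
  show "qcurve P 0 b 1 = q" by (simp add: qcurve_def b_def)
qed

text \<open>
  The numerator \<open>N\<close> and the denominator \<open>d\<close> of the projective map are affine, so the equation
  \<open>cdot (N x) (N x) = d x * cnj (d x)\<close> extends along a curve in the hyperquadric from the origin to any
  other of its points. A zero of \<open>d\<close> on the hyperquadric would be one of \<open>N\<close> too, hence one of the linear
  map \<open>D\<close>, and so the origin, where \<open>d\<close> equals \<open>b \<noteq> 0\<close>.
\<close>

lemma sphere_map_extends_at_0:
  fixes f :: "complex^('n::finite option) \<Rightarrow> complex^('n option)"
  assumes f: "biholomorphic_on f W" and W: "0 \<in> W"
    and sph: "\<And>x. x \<in> W \<inter> real_hyperquadric P \<Longrightarrow> cdot (f x) (f x) = 1"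
  obtains G X where "biholomorphic_on G X" "real_hyperquadric P \<subseteq> X"
    "\<And>x. x \<in> real_hyperquadric P \<Longrightarrow> cdot (G x) (G x) = 1" "\<forall>\<^sub>F x in nhds 0. G x = f x"
proof -
  obtain D E A b where D: "complex_linear D" and E: "complex_linear E" "\<And>v. E (D v) = v" "\<And>v. D (E v) = v"
    and A: "complex_functional A" and b: "b \<noteq> 0"
    and ev: "\<forall>\<^sub>F x in nhds 0. (b + A x) *s (f x - f 0) = D x"
    by (rule sphere_map_locally_projective[OF f W sph]) blast+
  \<comment> \<open>\<open>N / d\<close> is the projective map\<close>
  define d where "d x = b + A x" for x
  define N where "N x = d x *s f 0 + D x" for x
  have hold: "holomorphic_fun_on d UNIV"
    unfolding d_def by (intro holomorphic_fun_intros holomorphic_complex_functional A)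
  have holN: "holomorphic_fun_on (\<lambda>x. N x $ k) UNIV" for k
  proof -
    have "holomorphic_fun_on (\<lambda>x. D x $ k) UNIV"
      using holomorphic_complex_linear[OF D, of UNIV] by (simp add: holomorphic_map_on_iff_components)
    then have "holomorphic_fun_on (\<lambda>x. d x * f 0 $ k + D x $ k) UNIV"
      by (intro holomorphic_fun_intros hold)
    then show ?thesis by (simp add: N_def)
  qed
  have "\<forall>\<^sub>F x in nhds 0. x \<in> W"
    using f W by (intro eventually_nhds_in_open) (auto simp: biholomorphic_on_def)
  with ev have evN: "\<forall>\<^sub>F x in nhds 0. x \<in> W \<and> N x = d x *s f x"
    by eventually_elim (auto simp: N_def d_def algebra_simps)
  have NQ: "cdot (N q) (N q) = d q * cnj (d q)" if q: "q \<in> real_hyperquadric P" for q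
  proof -
    obtain v where v: "Im (v $ None) = 0" "qcurve P 0 v 0 = 0" "qcurve P 0 v 1 = q"
      using qcurve_from_0[OF q] .
    have "filterlim (qcurve P 0 v) (nhds 0) (nhds 0)"
      using tendsto_qcurve[of P 0 v 0] v by simp
    with evN have "\<forall>\<^sub>F \<tau> in nhds 0. qcurve P 0 v \<tau> \<in> W \<and> N (qcurve P 0 v \<tau>) = d (qcurve P 0 v \<tau>) *s f (qcurve P 0 v \<tau>)"
      by (rule eventually_compose_filterlim)
    then obtain e where e: "e > 0" "\<And>\<tau>. cmod \<tau> < e \<Longrightarrow>
        qcurve P 0 v \<tau> \<in> W \<and> N (qcurve P 0 v \<tau>) = d (qcurve P 0 v \<tau>) *s f (qcurve P 0 v \<tau>)"
      by (auto simp: eventually_nhds_metric dist_norm)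
    have "cdot (N (qcurve P 0 v 1)) (N (qcurve P 0 v (cnj 1))) =
       d (qcurve P 0 v 1) * cnj (d (qcurve P 0 v (cnj 1)))"
    proof (rule hermitian_identity[where F = "\<lambda>\<tau>. N (qcurve P 0 v \<tau>)" and d = "\<lambda>\<tau>. d (qcurve P 0 v \<tau>)" and S = UNIV and e = e])
      show "(\<lambda>\<tau>. N (qcurve P 0 v \<tau>) $ k) holomorphic_on UNIV" for k
        by (rule holomorphic_on_compose_curve[OF holN]) (auto intro: qcurve_holomorphic)
      show "(\<lambda>\<tau>. d (qcurve P 0 v \<tau>)) holomorphic_on UNIV"
        by (rule holomorphic_on_compose_curve[OF hold]) (auto intro: qcurve_holomorphic)
      show "cdot (N (qcurve P 0 v (of_real t))) (N (qcurve P 0 v (of_real t))) =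
          d (qcurve P 0 v (of_real t)) * cnj (d (qcurve P 0 v (of_real t)))" if "\<bar>t\<bar> < e" for t
      proof -
        have "qcurve P 0 v (of_real t) \<in> W \<inter> real_hyperquadric P"
          using e(2)[of "of_real t"] that qcurve_in_hyperquadric[of 0 v P t] v by simp
        from sph[OF this] show ?thesis using e(2)[of "of_real t"] that by simp
      qed
    qed (use e in auto)
    then show ?thesis using v by simp
  qed
  have dQ: "d q \<noteq> 0" if "q \<in> real_hyperquadric P" for q
  proof
    assume 0: "d q = 0"
    then have "N q = 0" using NQ[OF that] by simp
    then have "D q = 0" using 0 by (simp add: N_def)
    then have "q = 0" using E(2)[of q] complex_linearD(4)[OF E(1)] by simp
    then show False using 0 b complex_functionalD(4)[OF A] by (simp add: d_def)
  qed
  define G where "G = (\<lambda>x. f 0 + (1 / (b + A x)) *s D x)"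
  have G: "G x = (1 / d x) *s N x" if "d x \<noteq> 0" for x
    using that by (simp add: G_def N_def d_def[symmetric] vector_add_ldistrib)
  show thesis
  proof (rule that)
    show "biholomorphic_on G {x. d x \<noteq> 0}"
      unfolding G_def d_def by (rule projective_map_biholomorphic[OF D E A b])
    show "real_hyperquadric P \<subseteq> {x. d x \<noteq> 0}" using dQ by auto
    show "cdot (G x) (G x) = 1" if "x \<in> real_hyperquadric P" for x
      using G[OF dQ[OF that]] NQ[OF that] dQ[OF that] by simp
    have "open {x. d x \<noteq> 0}"
      using projective_map_biholomorphic[OF D E A b] by (simp add: biholomorphic_on_def d_def)
    then have "\<forall>\<^sub>F x in nhds 0. x \<in> {x. d x \<noteq> 0}"
      by (rule eventually_nhds_in_open) (use b in \<open>simp add: d_def complex_functionalD(4)[OF A]\<close>)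
    with evN show "\<forall>\<^sub>F x in nhds 0. G x = f x"
      by eventually_elim (simp add: G)
  qed
qed

lemma sphere_map_extends_to_hyperquadric:
  fixes f :: "complex^('n::finite option) \<Rightarrow> complex^('n option)"
  assumes f: "biholomorphic_on f W" and p: "p \<in> W" "p \<in> real_hyperquadric P"
    and sph: "\<And>x. x \<in> W \<inter> real_hyperquadric P \<Longrightarrow> cdot (f x) (f x) = 1"
  obtains G X where "biholomorphic_on G X" "real_hyperquadric P \<subseteq> X"
    "\<And>x. x \<in> real_hyperquadric P \<Longrightarrow> cdot (G x) (G x) = 1" "\<forall>\<^sub>F x in nhds p. G x = f x"
proof -
  let ?T = "qtranslate P p"
  obtain q where q: "q \<in> real_hyperquadric P" and TT: "\<And>x. ?T (qtranslate P q x) = x"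
      "\<And>x. qtranslate P q (?T x) = x"
    using qtranslate_inverse[OF p(2)] by metis
  let ?S = "qtranslate P q"
  have cont: "continuous_on UNIV (qtranslate P r)" for r
    by (intro holomorphic_map_on_imp_continuous_on holomorphic_qtranslate)
  have sub: "biholomorphic_on (qtranslate P r) (qtranslate P r -` Z)" if "r \<in> real_hyperquadric P" "open Z" for r Z
    using biholomorphic_on_open_subset[OF biholomorphic_qtranslate(1)[OF that(1)]]
      open_vimage[OF that(2) cont] by simp
  have "biholomorphic_on (\<lambda>x. f (?T x)) (?T -` W)"
    using f by (intro biholomorphic_on_compose[OF sub f] p) (auto simp: biholomorphic_on_def)
  then obtain G X where G: "biholomorphic_on G X" "real_hyperquadric P \<subseteq> X"
    "\<And>x. x \<in> real_hyperquadric P \<Longrightarrow> cdot (G x) (G x) = 1" "\<forall>\<^sub>F x in nhds 0. G x = f (?T x)"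
    by (rule sphere_map_extends_at_0[of _ _ P])
      (use p sph in \<open>auto simp: qtranslate_in_hyperquadric_iff[OF p(2)]\<close>)
  show thesis
  proof (rule that)
    show "biholomorphic_on (\<lambda>x. G (?S x)) (?S -` X)"
      using G by (intro biholomorphic_on_compose[OF sub G(1)] q) (auto simp: biholomorphic_on_def)
    show "real_hyperquadric P \<subseteq> ?S -` X"
      using G(2) qtranslate_in_hyperquadric_iff[OF q] by auto
    show "cdot (G (?S x)) (G (?S x)) = 1" if "x \<in> real_hyperquadric P" for x
      using that G(3) qtranslate_in_hyperquadric_iff[OF q] by simp
    have "?S p = 0" using TT(2)[of 0] by simp
    then have "filterlim ?S (nhds 0) (nhds p)"
      using cont[of q] by (metis UNIV_I continuous_on_eq_continuous_at isCont_def open_UNIV tendsto_nhds_iff)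
    with G(4) have "\<forall>\<^sub>F x in nhds p. G (?S x) = f (?T (?S x))"
      by (rule eventually_compose_filterlim)
    then show "\<forall>\<^sub>F x in nhds p. G (?S x) = f x" by (simp add: TT)
  qed
qed

text \<open>
  Conjugating by the chart turns \<open>f\<close> into a map of the hyperquadric. The domain \<open>V'\<close> may miss parts
  of \<open>V\<close> where the projective map has poles, but these lie off \<open>M\<close>.
\<close>

lemma sphere_map_extends_over_chart:
  fixes f :: "complex^('n::finite option) \<Rightarrow> complex^('n option)"
  assumes F: "biholomorphic_on F V" "F ` (V \<inter> M) = F ` V \<inter> real_hyperquadric P"
    and q: "q \<in> V \<inter> M" and f: "biholomorphic_on f W" "q \<in> W"
    and sph: "\<And>x. x \<in> W \<inter> M \<Longrightarrow> cdot (f x) (f x) = 1"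
  obtains g V' where "biholomorphic_on g V'" "V \<inter> M \<subseteq> V'"
    "\<And>x. x \<in> V' \<inter> M \<Longrightarrow> cdot (g x) (g x) = 1" "\<forall>\<^sub>F x in nhds q. g x = f x"
proof -
  have open_VW: "open V" "open W" and inj: "inj_on F V"
    using F f by (auto simp: biholomorphic_on_def)
  have FVW: "biholomorphic_on F (V \<inter> W)"
    using biholomorphic_on_open_subset[OF F(1)] open_VW by blast
  let ?h = "inv_into V F"
  have hF: "?h (F x) = x" if "x \<in> V" for x using that inj by simp
  have "biholomorphic_on ?h (F ` (V \<inter> W))"
    by (rule biholomorphic_on_open_subset[OF biholomorphic_on_inv_into[OF F(1)]])
      (use FVW in \<open>auto simp: biholomorphic_on_def\<close>)
  then have "biholomorphic_on (\<lambda>y. f (?h y)) (F ` (V \<inter> W))"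
    by (rule biholomorphic_on_compose[OF _ f(1)]) (auto simp: hF)
  then obtain G X where G: "biholomorphic_on G X" "real_hyperquadric P \<subseteq> X"
    "\<And>x. x \<in> real_hyperquadric P \<Longrightarrow> cdot (G x) (G x) = 1"
    "\<forall>\<^sub>F y in nhds (F q). G y = f (?h y)"
  proof (rule sphere_map_extends_to_hyperquadric[of _ _ "F q" P])
    show "F q \<in> F ` (V \<inter> W)" using q f by auto
    show "F q \<in> real_hyperquadric P" using q F(2) by blast
    fix y assume y: "y \<in> F ` (V \<inter> W) \<inter> real_hyperquadric P"
    then obtain x where x: "x \<in> V \<inter> W" "y = F x" by auto
    with y have "F x \<in> F ` (V \<inter> M)" using F(2) by auto
    then have "x \<in> M" using x inj by (auto dest: inj_onD)
    then show "cdot (f (?h y)) (f (?h y)) = 1" using sph x by (simp add: hF)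
  qed blast+
  have contF: "continuous_on V F"
    using F by (auto simp: biholomorphic_on_def intro: holomorphic_map_on_imp_continuous_on)
  define V' where "V' = V \<inter> F -` X"
  have "open V'"
    unfolding V'_def using G(1) contF open_VW
    by (intro continuous_open_preimage) (auto simp: biholomorphic_on_def)
  then have "biholomorphic_on F V'"
    using biholomorphic_on_open_subset[OF F(1)] by (simp add: V'_def)
  show thesis
  proof (rule that)
    show "biholomorphic_on (\<lambda>x. G (F x)) V'"
      by (rule biholomorphic_on_compose[OF \<open>biholomorphic_on F V'\<close> G(1)]) (auto simp: V'_def)
    show "V \<inter> M \<subseteq> V'" using F(2) G(2) by (auto simp: V'_def)
    show "cdot (G (F x)) (G (F x)) = 1" if "x \<in> V' \<inter> M" for x
      using that F(2) by (intro G(3)) (auto simp: V'_def)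
    have "filterlim F (nhds (F q)) (nhds q)"
      using contF open_VW q by (metis IntD1 continuous_on_eq_continuous_at isCont_def tendsto_nhds_iff)
    with G(4) have "\<forall>\<^sub>F x in nhds q. G (F x) = f (?h (F x))"
      by (rule eventually_compose_filterlim)
    moreover have "\<forall>\<^sub>F x in nhds q. x \<in> V"
      using open_VW q by (intro eventually_nhds_in_open) auto
    ultimately show "\<forall>\<^sub>F x in nhds q. G (F x) = f x"
      by eventually_elim (simp add: hF)
  qed
qed

section \<open>Continuation along a path\<close>

lemma germ_eq_iff: "germ f x = germ g x \<longleftrightarrow> (\<forall>\<^sub>F y in nhds x. f y = g y)"
proof
  assume "germ f x = germ g x"
  moreover have "f \<in> germ f x" by (simp add: germ_def)
  ultimately show "\<forall>\<^sub>F y in nhds x. f y = g y" by (simp add: germ_def)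
next
  assume fg: "\<forall>\<^sub>F y in nhds x. f y = g y"
  have "(\<forall>\<^sub>F y in nhds x. h y = f y) \<longleftrightarrow> (\<forall>\<^sub>F y in nhds x. h y = g y)" for h
  proof
    assume "\<forall>\<^sub>F y in nhds x. h y = f y"
    with fg show "\<forall>\<^sub>F y in nhds x. h y = g y" by eventually_elim simp
  next
    assume "\<forall>\<^sub>F y in nhds x. h y = g y"
    with fg show "\<forall>\<^sub>F y in nhds x. h y = f y" by eventually_elim simp
  qed
  then show "germ f x = germ g x" by (auto simp: germ_def)
qed

text \<open>
  A continuation over \<open>{0..a}\<close> whose representatives map \<open>M\<close> into the sphere; this is what allows
  one to extend it further. The condition on \<open>s\<close> near \<open>t\<close> includes \<open>s = t\<close>, so that it also says that
  \<open>\<gamma> t \<in> V\<close> and that \<open>\<Phi> t\<close> is the germ of \<open>f\<close>.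
\<close>

definition sphere_continuation ::
    "(complex^'m) set \<Rightarrow> (complex^'m \<Rightarrow> complex^'m) \<Rightarrow> (real \<Rightarrow> complex^'m) \<Rightarrow>
     (real \<Rightarrow> (complex^'m \<Rightarrow> complex^'m) set) \<Rightarrow> real \<Rightarrow> bool" where
  "sphere_continuation M \<phi> \<gamma> \<Phi> a \<longleftrightarrow>
     \<Phi> 0 = germ \<phi> (\<gamma> 0) \<and>
     (\<forall>t\<in>{0..a}. \<exists>V f. biholomorphic_on f V \<and> (\<forall>x\<in>V \<inter> M. cdot (f x) (f x) = 1) \<and>
        (\<forall>\<^sub>F s in nhds t. s \<in> {0..a} \<longrightarrow> \<gamma> s \<in> V \<and> \<Phi> s = germ f (\<gamma> s)))"

lemma eventually_nhds_path_in_open: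
  assumes "continuous_on {0..1} \<gamma>" "t \<in> {0..1}" "open V" "\<gamma> t \<in> V"
  shows "\<forall>\<^sub>F s in nhds t. s \<in> {0..1} \<longrightarrow> \<gamma> s \<in> V"
proof -
  have "(\<gamma> \<longlongrightarrow> \<gamma> t) (at t within {0..1})"
    using assms by (simp add: continuous_on_def)
  then have "\<forall>\<^sub>F s in at t within {0..1}. \<gamma> s \<in> V"
    using assms by (intro topological_tendstoD)
  then have "\<forall>\<^sub>F s in nhds t. s \<noteq> t \<longrightarrow> s \<in> {0..1} \<longrightarrow> \<gamma> s \<in> V"
    by (simp add: eventually_at_filter)
  then show ?thesis by eventually_elim (use assms(4) in auto)
qed

lemma sphere_continuation_extend:
  assumes \<Phi>: "sphere_continuation M \<phi> \<gamma> \<Phi> a" and a: "0 \<le> a" "a \<le> b" "b \<le> 1"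
    and \<gamma>: "continuous_on {0..1} \<gamma>"
    and g: "biholomorphic_on g V'" "\<And>x. x \<in> V' \<inter> M \<Longrightarrow> cdot (g x) (g x) = 1" "\<gamma> ` {a..b} \<subseteq> V'"
    and ga: "\<Phi> a = germ g (\<gamma> a)"
  shows "sphere_continuation M \<phi> \<gamma> (\<lambda>s. if s \<le> a then \<Phi> s else germ g (\<gamma> s)) b"
  unfolding sphere_continuation_def
proof (intro conjI ballI)
  let ?\<Phi> = "\<lambda>s. if s \<le> a then \<Phi> s else germ g (\<gamma> s)"
  show "?\<Phi> 0 = germ \<phi> (\<gamma> 0)" using \<Phi> a by (simp add: sphere_continuation_def)
  fix t assume t: "t \<in> {0..b}"
  have V': "open V'" using g by (simp add: biholomorphic_on_def)
  show "\<exists>V f. biholomorphic_on f V \<and> (\<forall>x\<in>V \<inter> M. cdot (f x) (f x) = 1) \<and>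
        (\<forall>\<^sub>F s in nhds t. s \<in> {0..b} \<longrightarrow> \<gamma> s \<in> V \<and> ?\<Phi> s = germ f (\<gamma> s))"
  proof (cases "t > a")
    case True
    have "\<forall>\<^sub>F s in nhds t. s \<in> {0..1} \<longrightarrow> \<gamma> s \<in> V'"
      using t a g(3) True V' by (intro eventually_nhds_path_in_open \<gamma>) (auto simp: subset_iff)
    moreover have "\<forall>\<^sub>F s in nhds t. s \<in> {a<..}"
      using True by (intro eventually_nhds_in_open) auto
    ultimately have "\<forall>\<^sub>F s in nhds t. s \<in> {0..b} \<longrightarrow> \<gamma> s \<in> V' \<and> ?\<Phi> s = germ g (\<gamma> s)"
      by eventually_elim (use a in auto)
    with g show ?thesis by blast
  next
    case ta: False
    with t have "t \<in> {0..a}" by auto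
    then obtain V f where f: "biholomorphic_on f V" "\<forall>x\<in>V \<inter> M. cdot (f x) (f x) = 1"
      and ev: "\<forall>\<^sub>F s in nhds t. s \<in> {0..a} \<longrightarrow> \<gamma> s \<in> V \<and> \<Phi> s = germ f (\<gamma> s)"
      using \<Phi> unfolding sphere_continuation_def by blast
    have gt: "\<gamma> t \<in> V" "\<Phi> t = germ f (\<gamma> t)"
      using eventually_nhds_x_imp_x[OF ev] \<open>t \<in> {0..a}\<close> by auto
    show ?thesis
    proof (cases "t = a")
      case False
      then have "\<forall>\<^sub>F s in nhds t. s \<in> {..<a}"
        using ta by (intro eventually_nhds_in_open) auto
      with ev have "\<forall>\<^sub>F s in nhds t. s \<in> {0..b} \<longrightarrow> \<gamma> s \<in> V \<and> ?\<Phi> s = germ f (\<gamma> s)"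
        by eventually_elim auto
      with f show ?thesis by blast
    next
      case True
      \<comment> \<open>at the junction both germs have to come from one representative\<close>
      have "\<forall>\<^sub>F x in nhds (\<gamma> a). f x = g x"
        using gt ga True by (simp flip: germ_eq_iff)
      then obtain Z where Z: "open Z" "\<gamma> a \<in> Z" "\<And>x. x \<in> Z \<Longrightarrow> f x = g x"
        by (auto simp: eventually_nhds)
      have fg: "germ g x = germ f x" if "x \<in> Z" for x
        unfolding germ_eq_iff eventually_nhds using Z that by metis
      have V: "open V" using f by (simp add: biholomorphic_on_def)
      have "\<forall>\<^sub>F s in nhds t. s \<in> {0..1} \<longrightarrow> \<gamma> s \<in> V \<inter> Z"
        using t a gt True V Z by (intro eventually_nhds_path_in_open \<gamma>) auto
      with ev have "\<forall>\<^sub>F s in nhds t. s \<in> {0..b} \<longrightarrow> \<gamma> s \<in> V \<and> ?\<Phi> s = germ f (\<gamma> s)"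
        by eventually_elim (use a fg in auto)
      with f show ?thesis by blast
    qed
  qed
qed

lemma sphere_continuation_imp_analytic:
  assumes "sphere_continuation M \<phi> \<gamma> \<Phi> 1"
  shows "analytic_continuation_along \<phi> \<gamma> \<Phi>"
  unfolding analytic_continuation_along_def
proof (intro conjI ballI)
  show "\<Phi> 0 = germ \<phi> (\<gamma> 0)" using assms by (simp add: sphere_continuation_def)
  fix t :: real assume t: "t \<in> {0..1}"
  then obtain V f where f: "biholomorphic_on f V"
    and ev: "\<forall>\<^sub>F s in nhds t. s \<in> {0..1} \<longrightarrow> \<gamma> s \<in> V \<and> \<Phi> s = germ f (\<gamma> s)"
    using assms unfolding sphere_continuation_def by blast
  show "\<exists>V f. open V \<and> \<gamma> t \<in> V \<and> locally_biholomorphic_on f V \<and> \<Phi> t = germ f (\<gamma> t) \<and>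
      (\<forall>\<^sub>F s in at t within {0..1}. \<gamma> s \<in> V \<and> \<Phi> s = germ f (\<gamma> s))"
  proof (intro exI conjI)
    show "open V" using f by (simp add: biholomorphic_on_def)
    show "locally_biholomorphic_on f V" by (rule biholomorphic_on_imp_locally[OF f])
    show "\<gamma> t \<in> V" "\<Phi> t = germ f (\<gamma> t)" using eventually_nhds_x_imp_x[OF ev] t by auto
    show "\<forall>\<^sub>F s in at t within {0..1}. \<gamma> s \<in> V \<and> \<Phi> s = germ f (\<gamma> s)"
      unfolding eventually_at_filter using ev by eventually_elim auto
  qed
qed

theorem theorem0p2:
  fixes M U :: "(complex^('n::finite option)) set"
    and p :: "complex^('n option)"
    and \<phi> :: "complex^('n option) \<Rightarrow> complex^('n option)"
  assumes "analytic_real_hypersurface M" "strongly_pseudoconvex M" "spherical M"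
    and "p \<in> M"
    and "open U" "connected U" "p \<in> U"
    and "biholomorphic_on \<phi> U"
    and "\<phi> ` (U \<inter> M) \<subseteq> sphere 0 1"
  shows "\<forall>\<gamma>. path \<gamma> \<and> path_image \<gamma> \<subseteq> M \<and> pathstart \<gamma> = p \<longrightarrow>
           (\<exists>\<Phi>. analytic_continuation_along \<phi> \<gamma> \<Phi>)"
proof (intro allI impI, elim conjE)
  fix \<gamma> :: "real \<Rightarrow> complex^('n option)"
  assume path: "path \<gamma>" "path_image \<gamma> \<subseteq> M" "pathstart \<gamma> = p"
  have \<gamma>: "continuous_on {0..1} \<gamma>" using path(1) by (simp add: path_def)
  have \<gamma>M: "\<gamma> s \<in> M" if "s \<in> {0..1}" for s using path(2) that by (auto simp: path_image_def)
  define Q where "Q c d \<longleftrightarrow> (0 \<le> c \<and> d \<le> 1 \<longrightarrow>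
     (\<forall>\<Phi>. sphere_continuation M \<phi> \<gamma> \<Phi> c \<longrightarrow> (\<exists>\<Phi>'. sphere_continuation M \<phi> \<gamma> \<Phi>' d)))" for c d :: real
  have "Q 0 1"
  proof (rule Bolzano)
    show "(0::real) \<le> 1" by simp
    show "Q c e" if "Q c d" "Q d e" "c \<le> d" "d \<le> e" for c d e
      using that unfolding Q_def by (meson order_trans)
    fix x :: real
    assume x: "0 \<le> x" "x \<le> 1"
    obtain V F P where V: "\<gamma> x \<in> V" and F: "biholomorphic_on F V" "F ` (V \<inter> M) = F ` V \<inter> real_hyperquadric P"
      using \<open>spherical M\<close> \<gamma>M[of x] x unfolding spherical_def by (metis atLeastAtMost_iff)
    have "open V" using F by (simp add: biholomorphic_on_def)
    then have "\<forall>\<^sub>F s in nhds x. s \<in> {0..1} \<longrightarrow> \<gamma> s \<in> V"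
      using x V by (intro eventually_nhds_path_in_open \<gamma>) auto
    then obtain \<delta> where \<delta>: "\<delta> > 0" "\<And>s. \<bar>s - x\<bar> < \<delta> \<Longrightarrow> s \<in> {0..1} \<Longrightarrow> \<gamma> s \<in> V"
      by (auto simp: eventually_nhds_metric dist_real_def)
    have "Q c d" if cd: "c \<le> x" "x \<le> d" "d - c < \<delta>" for c d
      unfolding Q_def
    proof (intro impI allI, elim conjE)
      fix \<Phi> assume cd': "0 \<le> c" "d \<le> 1" and \<Phi>: "sphere_continuation M \<phi> \<gamma> \<Phi> c"
      have sub: "\<gamma> s \<in> V \<inter> M" if "s \<in> {c..d}" for s
        using \<delta>(2)[of s] \<gamma>M[of s] that cd cd' by auto
      have "c \<in> {0..c}" using cd'(1) by simp
      with \<Phi> obtain W f where f: "biholomorphic_on f W" "\<forall>x\<in>W \<inter> M. cdot (f x) (f x) = 1"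
        and ev: "\<forall>\<^sub>F s in nhds c. s \<in> {0..c} \<longrightarrow> \<gamma> s \<in> W \<and> \<Phi> s = germ f (\<gamma> s)"
        unfolding sphere_continuation_def by blast
      have fc: "\<gamma> c \<in> W" "\<Phi> c = germ f (\<gamma> c)"
        using eventually_nhds_x_imp_x[OF ev] cd' by auto
      obtain g V' where g: "biholomorphic_on g V'" "V \<inter> M \<subseteq> V'"
          "\<And>x. x \<in> V' \<inter> M \<Longrightarrow> cdot (g x) (g x) = 1" "\<forall>\<^sub>F x in nhds (\<gamma> c). g x = f x"
        using sphere_map_extends_over_chart[OF F sub[of c] f(1) fc(1)] f(2) cd by auto
      have "\<Phi> c = germ g (\<gamma> c)" using fc g(4) by (simp add: germ_eq_iff[of g _ f, symmetric])
      moreover have "\<gamma> ` {c..d} \<subseteq> V'" using sub g(2) by blast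
      ultimately show "\<exists>\<Phi>'. sphere_continuation M \<phi> \<gamma> \<Phi>' d"
        using sphere_continuation_extend[OF \<Phi> cd'(1) _ cd'(2) \<gamma> g(1,3)] cd by auto
    qed
    then show "\<exists>\<delta>>0. \<forall>c d. c \<le> x \<and> x \<le> d \<and> d - c < \<delta> \<longrightarrow> Q c d" using \<delta>(1) by blast
  qed
  moreover have "sphere_continuation M \<phi> \<gamma> (\<lambda>s. germ \<phi> (\<gamma> s)) 0"
    unfolding sphere_continuation_def
  proof (intro conjI ballI refl)
    fix t :: real assume "t \<in> {0..0}"
    have "\<gamma> 0 \<in> U" using path(3) \<open>p \<in> U\<close> by (simp add: pathstart_def)
    then have "\<forall>\<^sub>F s in nhds t. s \<in> {0..0} \<longrightarrow> \<gamma> s \<in> U \<and> germ \<phi> (\<gamma> s) = germ \<phi> (\<gamma> s)"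
      by (intro always_eventually) auto
    moreover have "\<forall>x\<in>U \<inter> M. cdot (\<phi> x) (\<phi> x) = 1"
      using assms(9) by (metis image_subset_iff in_unit_sphere_iff)
    ultimately show "\<exists>V f. biholomorphic_on f V \<and> (\<forall>x\<in>V \<inter> M. cdot (f x) (f x) = 1) \<and>
        (\<forall>\<^sub>F s in nhds t. s \<in> {0..0} \<longrightarrow> \<gamma> s \<in> V \<and> germ \<phi> (\<gamma> s) = germ f (\<gamma> s))"
      using assms(8) by blast
  qed
  ultimately obtain \<Phi> where "sphere_continuation M \<phi> \<gamma> \<Phi> 1"
    unfolding Q_def by auto
  then show "\<exists>\<Phi>. analytic_continuation_along \<phi> \<gamma> \<Phi>"
    using sphere_continuation_imp_analytic by blast
qed

end
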